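(* For every $\epsilon>0$ there is a constant $C_\epsilon$ such that for all integers $N,M\ge 1$ $$\left\|\sum_{n=1}^N\sum_{m=1}^M e(nx_1+mx_2+nmx_3+n^2x_4+m^2x_5)\right\|^8_{L^8([0,1]^5)}\le C_\epsilon\,(NM)^{1+\epsilon}\,(N^3M^3+N^4+M^4),$$ where the $L^8$ norm is taken with respect to Lebesgue measure in the variables $(x_1,\ldots,x_5)\in[0,1]^5$.
   Context: $e(t)=e^{2\pi i t}$ for real $t$. The integers $N$ and $M$ are unrelated to each other, and the constant $C_\epsilon$ depends only on $\epsilon$. *)

theory Defs
  imports "HOL-Analysis.Analysis"
begin

definition e_unit :: "real \<Rightarrow> complex" where
  "e_unit t = exp (2 * complex_of_real pi * \<i> * complex_of_real t)"

(* Meant for finite p > 0 and functions with |f|^p integrable over S (automatic for the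
   continuous functions on compact sets to which it is applied); the Bochner integral
   of a non-integrable function is 0, not infinity. *)
definition Lp_norm :: "real \<Rightarrow> 'a::euclidean_space set \<Rightarrow> ('a \<Rightarrow> complex) \<Rightarrow> real" where
  "Lp_norm p S f = (LINT x:S|lebesgue. norm (f x) powr p) powr (1 / p)"

(* In the index type 5 the numeral 5 denotes the same element as 0, so 1, 2, 3, 4, 5
   are exactly its five elements. *)
definition exp_sum :: "nat \<Rightarrow> nat \<Rightarrow> real ^ 5 \<Rightarrow> complex" where
  "exp_sum N M x =
     (\<Sum>n=1..N. \<Sum>m=1..M.
        e_unit (real n * x $ 1 + real m * x $ 2 + real n * real m * x $ 3
           + (real n)\<^sup>2 * x $ 4 + (real m)\<^sup>2 * x $ 5))"

end

theory Submission
  imports Defs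
begin

text \<open>
By orthogonality of characters, the eighth power of the norm is the number of pairs of quadruples of grid
points $(n, m)$ with equal sums of $n$, $m$, $nm$, $n^2$ and $m^2$ (lemma \<open>Lp_norm_exp_sum\<close>).
The equations for the sums of $n$ and of $m$ are separated off by the $4 \times 4$ Hadamard matrix:
apart from these sums, which take at most $16NM$ values, the two coordinate sequences of a quadruple turn
into vectors $u, v$ with three integer coordinates, and the other equations say that $(u, v)$ and $(u', v')$ have the
same Gram matrix.  For $x = u - u'$, $y = u + u'$, $p = v - v'$, $q = v + v'$ this means
\[ x \cdot y = 0, \qquad p \cdot q = 0, \qquad x \cdot q + y \cdot p = 0 \]
(lemma \<open>card_equal_moments\<close>).

The quadratic form $x \cdot y$ in six variables is the Pluecker form.  So $(x, y)$ and $(p, q)$ are lines in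
projective three-space, and the last equation says that they meet.  It remains to count pairs of meeting lines
of heights at most $R = 4N$ and $T = 4M$; by symmetry let $T \le R$.  The degenerate case $p = q = 0$
accounts for the term $R^4$, the others for $R^3 T^3$, up to $\epsilon$ in the exponents (lemma
\<open>card_meeting_pairs\<close>).

Fix the line $(p, q)$.  It corresponds to a lattice of rank two in the integer vectors with four coordinates, with a
reduced basis $a, c$; its dual corresponds to the orthogonal lattice, with a reduced basis $b, d$.  A line
$X$ that meets it, seen as a skew matrix of rank two, maps $b$ and $d$ to parallel vectors in the
lattice of $a$ and $c$.  So $X$ is described by a singular $2 \times 2$ integer matrix, up to adding multiples of the
wedge product of $a$ and $c$.  The bound for the number of divisors controls the number of singular matrices, and this gives at most about
$R^{3+\epsilon}(|a|^{-2} + |b|^{-2})$ lines $X$ (lemma \<open>card_meeting_lines\<close>).  The number of such $X$ can exceed the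
expected order $R^3/T$ when the lattice is very skew, so the bound has to be averaged over
$(p, q)$.  A vector $a$ is shortest in the lattices of at most about $T^3/|a|^2$ lines, and therefore
\[ \sum_{(p, q)} |a|^{-2} \ll T^3 \sum_{|a|^2 \ll T} |a|^{-4} \ll T^3 \log T \]
(lemma \<open>sum_inverse_shortest\<close>).
\<close>

section \<open>The divisor bound\<close>

lemma card_divisors_prime_power_mult:
  fixes p m k :: nat
  assumes "prime p" and "m > 0"
  shows "card {d. d dvd p ^ k * m} \<le> (k + 1) * card {d. d dvd m}"
proof -
  have "{d. d dvd p ^ k * m} \<subseteq> (\<lambda>(i, e). p ^ i * e) ` ({..k} \<times> {d. d dvd m})"
  proof
    fix d assume "d \<in> {d. d dvd p ^ k * m}"
    then obtain b c where "d = b * c" "b dvd p ^ k" "c dvd m"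
      using division_decomp by blast
    moreover from this(2) obtain i where "i \<le> k" "b = p ^ i"
      using assms(1) divides_primepow_nat by blast
    ultimately show "d \<in> (\<lambda>(i, e). p ^ i * e) ` ({..k} \<times> {d. d dvd m})"
      by (intro image_eqI[of _ _ "(i, c)"]) auto
  qed
  moreover have fin: "finite ({..k} \<times> {d. d dvd m})"
    using assms(2) by simp
  ultimately have "card {d. d dvd p ^ k * m} \<le> card ({..k} \<times> {d. d dvd m})"
    by (meson card_image_le card_mono finite_imageI le_trans)
  then show ?thesis
    by (simp add: card_cartesian_product)
qed

text \<open>The number of divisors of $n$ is at most the product of $k+1$ over the prime powers $p^k$ exactly
dividing $n$.  Against this, $n^\epsilon$ offers a factor $p^{k\epsilon}$, which is at least
$2^k \ge k+1$ as soon as $p \ge 2^{1/\epsilon}$.  Each of the boundedly many smaller primes costs a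
constant factor.\<close>

theorem divisor_bound:
  fixes \<epsilon> :: real
  assumes "\<epsilon> > 0"
  shows "\<exists>C\<ge>1. \<forall>n::nat. n > 0 \<longrightarrow> real (card {d. d dvd n}) \<le> C * real n powr \<epsilon>"
proof -
  define P where "P = nat \<lceil>2 powr (1 / \<epsilon>)\<rceil>"
  \<comment> \<open>at a small prime, $k + 1 \le c\,2^{k\epsilon}$ because $2^{k\epsilon} \ge 1 + k \epsilon \ln 2$\<close>
  define c where "c = max 1 (1 / (\<epsilon> * ln 2))"
  have c1: "c \<ge> 1" by (simp add: c_def)
  define S where "S = (\<lambda>n. {p::nat. prime p \<and> p dvd n \<and> p < P})"
  have finS: "finite (S n)" for n
    by (rule finite_subset[of _ "{..<P}"]) (auto simp: S_def)
  have small: "real (k + 1) \<le> c * real (p ^ k) powr \<epsilon>" if "prime p" for p k :: nat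
  proof -
    have "1 + real k * (\<epsilon> * ln 2) \<le> exp (real k * (\<epsilon> * ln 2))"
      by (rule exp_ge_add_one_self)
    also have "\<dots> = (2 ^ k) powr \<epsilon>"
      by (simp add: powr_def ln_realpow mult_ac)
    also have "\<dots> \<le> real (p ^ k) powr \<epsilon>"
      using assms prime_ge_2_nat[OF that] by (intro powr_mono2) (auto intro: power_mono)
    finally have *: "1 + real k * (\<epsilon> * ln 2) \<le> real (p ^ k) powr \<epsilon>" .
    have "c * (\<epsilon> * ln 2) \<ge> 1"
      using assms by (simp add: c_def max_def field_simps)
    then have "real k * 1 \<le> real k * (c * (\<epsilon> * ln 2))"
      by (intro mult_left_mono) auto
    then have "real (k + 1) \<le> c * (1 + real k * (\<epsilon> * ln 2))"
      using c1 by (simp add: algebra_simps)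
    also have "\<dots> \<le> c * real (p ^ k) powr \<epsilon>"
      using * c1 by (intro mult_left_mono) auto
    finally show ?thesis .
  qed
  have large: "real (k + 1) \<le> real (p ^ k) powr \<epsilon>" if "p \<ge> P" for p k :: nat
  proof -
    have "2 powr (1 / \<epsilon>) \<le> real P"
      unfolding P_def by linarith
    then have "2 powr (1 / \<epsilon>) \<le> real p"
      using that by linarith
    then have "(2 powr (1 / \<epsilon>)) powr \<epsilon> \<le> real p powr \<epsilon>"
      using assms by (intro powr_mono2) auto
    then have "2 \<le> real p powr \<epsilon>"
      using assms by (simp add: powr_powr)
    then have "2 ^ k \<le> (real p powr \<epsilon>) ^ k"
      by (intro power_mono) auto
    also have "(real p powr \<epsilon>) ^ k = real (p ^ k) powr \<epsilon>"
      using \<open>2 powr (1 / \<epsilon>) \<le> real p\<close>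
      by (cases "p = 0") (simp_all add: powr_powr mult.commute flip: powr_realpow)
    finally have "2 ^ k \<le> real (p ^ k) powr \<epsilon>" .
    moreover have "real (k + 1) \<le> 2 ^ k"
      using less_exp[of k] by (metis Suc_eq_plus1 Suc_leI of_nat_le_iff of_nat_numeral of_nat_power)
    ultimately show ?thesis by linarith
  qed
  have main: "real (card {d. d dvd n}) \<le> c ^ card (S n) * real n powr \<epsilon>" if "n > 0" for n
    using that
  proof (induction n rule: less_induct)
    case (less n)
    show ?case
    proof (cases "n = 1")
      case True
      then show ?thesis using c1 by (simp add: one_le_power)
    next
      case False
      then obtain p where p: "prime p" "p dvd n"
        using prime_factor_nat by blast
      obtain k m where km: "n = p ^ k * m" "\<not> p dvd m" "k > 0"
        using less.prems p multiplicity_decompose'[of n p] prime_multiplicity_gt_zero_iff[of p n]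
        by (metis not_prime_unit not_gr_zero prime_elem_multiplicity_eq_zero_iff prime_imp_prime_elem)
      have m0: "m > 0" using km(2) by (cases m) auto
      have "1 < p ^ k" using p(1) km(3) prime_gt_1_nat one_less_power by blast
      then have "m < n" using km(1) m0 by simp
      note IH = less.IH[OF this m0]
      have "real (card {d. d dvd n}) \<le> real ((k + 1) * card {d. d dvd m})"
        unfolding km(1) using card_divisors_prime_power_mult[OF p(1) m0] of_nat_mono by blast
      also have "\<dots> = real (k + 1) * real (card {d. d dvd m})" by (rule of_nat_mult)
      also have "\<dots> \<le> real (k + 1) * (c ^ card (S m) * real m powr \<epsilon>)"
        using IH by (intro mult_left_mono) auto
      also have "\<dots> \<le> c ^ card (S n) * real n powr \<epsilon>"
      proof (cases "p < P")
        case True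
        have "S n = insert p (S m)"
          using p(1) km True by (auto simp: S_def prime_dvd_mult_iff prime_dvd_power_iff primes_dvd_imp_eq)
        moreover have "p \<notin> S m" using km by (simp add: S_def)
        ultimately have cs: "card (S n) = Suc (card (S m))" using finS by simp
        have "real (k + 1) * (c ^ card (S m) * real m powr \<epsilon>)
           \<le> (c * real (p ^ k) powr \<epsilon>) * (c ^ card (S m) * real m powr \<epsilon>)"
          using small[OF p(1)] c1 by (intro mult_right_mono) auto
        then show ?thesis
          unfolding cs by (simp add: km(1) powr_mult mult_ac)
      next
        case False
        have "S m \<subseteq> S n" using km by (auto simp: S_def)
        then have "c ^ card (S m) \<le> c ^ card (S n)"
          using c1 finS by (intro power_increasing card_mono) auto
        moreover have "real (k + 1) * (c ^ card (S m) * real m powr \<epsilon>)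
           \<le> real (p ^ k) powr \<epsilon> * (c ^ card (S m) * real m powr \<epsilon>)"
          using large[of p k] False c1 by (intro mult_right_mono) auto
        ultimately have "real (k + 1) * (c ^ card (S m) * real m powr \<epsilon>)
           \<le> real (p ^ k) powr \<epsilon> * (c ^ card (S n) * real m powr \<epsilon>)"
          by (smt (verit) mult_left_mono mult_right_mono powr_ge_zero)
        then show ?thesis
          by (simp add: km(1) powr_mult mult_ac)
      qed
      finally show ?thesis .
    qed
  qed
  have "card (S n) \<le> P" for n
    using card_mono[of "{..<P}" "S n"] by (auto simp: S_def)
  then have "c ^ card (S n) * real n powr \<epsilon> \<le> c ^ P * real n powr \<epsilon>" for n
    using c1 by (intro mult_right_mono power_increasing) auto
  then show ?thesis
    using main c1 by (intro exI[of _ "c ^ P"] conjI allI impI) (auto intro: order_trans)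
qed

section \<open>Singular integer matrices of size two\<close>

lemma abs_le_real_eq: "{k::int. \<bar>real_of_int k\<bar> \<le> K} = {- \<lfloor>K\<rfloor>..\<lfloor>K\<rfloor>}"
proof -
  have "\<bar>real_of_int k\<bar> \<le> K \<longleftrightarrow> - \<lfloor>K\<rfloor> \<le> k \<and> k \<le> \<lfloor>K\<rfloor>" for k :: int
    by (auto simp: abs_le_iff le_floor_iff minus_le_iff[of "\<lfloor>K\<rfloor>"])
  then show ?thesis
    unfolding set_eq_iff mem_Collect_eq atLeastAtMost_iff by blast
qed

lemma finite_abs_le_real [simp]: "finite {k::int. \<bar>real_of_int k\<bar> \<le> K}"
  by (simp add: abs_le_real_eq)

lemma card_abs_le_real:
  assumes "K \<ge> 0"
  shows "real (card {k::int. \<bar>real_of_int k\<bar> \<le> K}) \<le> 2 * K + 1"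
  unfolding abs_le_real_eq using assms by simp

text \<open>Factorizations are determined by their first factor, which is a divisor up to sign.\<close>

lemma card_factorizations:
  fixes n :: int
  assumes "n \<noteq> 0"
  shows "finite {(b, c). b * c = n}"
    and "card {(b, c). b * c = n} \<le> 2 * card {d. d dvd nat \<bar>n\<bar>}"
proof -
  let ?D = "{d. d dvd nat \<bar>n\<bar>}"
  have fin: "finite ?D" using assms by (intro finite_divisors_nat) simp
  have sub: "fst ` {(b, c). b * c = n} \<subseteq> int ` ?D \<union> (\<lambda>d. - int d) ` ?D"
  proof
    fix b assume "b \<in> fst ` {(b, c). b * c = n}"
    then have "b dvd n" by auto
    then have "nat \<bar>b\<bar> dvd nat \<bar>n\<bar>" by (simp add: nat_dvd_iff)
    moreover have "b = int (nat \<bar>b\<bar>) \<or> b = - int (nat \<bar>b\<bar>)" by auto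
    ultimately show "b \<in> int ` ?D \<union> (\<lambda>d. - int d) ` ?D" by blast
  qed
  have inj: "inj_on fst {(b, c). b * c = n}"
  proof (rule inj_onI, clarify)
    fix b c b' c' :: int
    assume "n = b * c" "b' * c' = b * c" "fst (b, c) = fst (b', c')"
    then show "b = b' \<and> c = c'" using assms by simp
  qed
  have finI: "finite (fst ` {(b, c). b * c = n})"
    using sub fin by (meson finite_UnI finite_imageI finite_subset)
  then show "finite {(b, c). b * c = n}"
    using inj finite_image_iff by blast
  have "card {(b, c). b * c = n} = card (fst ` {(b, c). b * c = n})"
    using inj by (simp add: card_image)
  also have "\<dots> \<le> card (int ` ?D \<union> (\<lambda>d. - int d) ` ?D)"
    using sub fin by (intro card_mono) auto
  also have "\<dots> \<le> card (int ` ?D) + card ((\<lambda>d. - int d) ` ?D)"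
    by (rule card_Un_le)
  also have "\<dots> \<le> card ?D + card ?D"
    using fin by (intro add_mono card_image_le)
  finally show "card {(b, c). b * c = n} \<le> 2 * card ?D" by simp
qed

lemma card_factorizations_powr:
  fixes \<epsilon> :: real
  assumes "\<epsilon> > 0"
  shows "\<exists>C\<ge>1. \<forall>(n::int) Q. n \<noteq> 0 \<longrightarrow> \<bar>real_of_int n\<bar> \<le> Q \<longrightarrow>
           real (card {(b, c). b * c = n}) \<le> C * Q powr \<epsilon>"
proof -
  obtain C where C: "C \<ge> 1" "\<And>n::nat. n > 0 \<Longrightarrow> real (card {d. d dvd n}) \<le> C * real n powr \<epsilon>"
    using divisor_bound[OF assms] by blast
  have "real (card {(b, c). b * c = n}) \<le> (2 * C) * Q powr \<epsilon>"
    if "n \<noteq> 0" "\<bar>real_of_int n\<bar> \<le> Q" for n :: int and Q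
  proof -
    have "real (card {(b, c). b * c = n}) \<le> 2 * real (card {d. d dvd nat \<bar>n\<bar>})"
      using card_factorizations(2)[OF that(1)] by linarith
    also have "\<dots> \<le> 2 * (C * real (nat \<bar>n\<bar>) powr \<epsilon>)"
      using C(2)[of "nat \<bar>n\<bar>"] that(1) by simp
    also have "\<dots> \<le> 2 * (C * Q powr \<epsilon>)"
      using that assms C(1) by (intro mult_left_mono powr_mono2) auto
    finally show ?thesis by simp
  qed
  moreover have "1 \<le> 2 * C" using C(1) by simp
  ultimately show ?thesis by blast
qed

text \<open>The matrices with rows $(a, b)$ and $(c, d)$.  The entries are grouped by diagonals because each
diagonal, once its product is nonzero, leaves few choices for the other one.\<close>

definition singular_matrices :: "real \<Rightarrow> real \<Rightarrow> real \<Rightarrow> real \<Rightarrow> ((int \<times> int) \<times> (int \<times> int)) set" where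
  "singular_matrices A B C D = {((a, d), (b, c)).
     \<bar>real_of_int a\<bar> \<le> A \<and> \<bar>real_of_int d\<bar> \<le> D \<and>
     \<bar>real_of_int b\<bar> \<le> B \<and> \<bar>real_of_int c\<bar> \<le> C \<and> a * d = b * c}"

text \<open>If $ad \ne 0$, the pair $(b, c)$ is one of the factorizations of $ad$, of which there are few.
If $ad = bc = 0$, one diagonal entry and one antidiagonal entry vanish, and the other two entries
range freely over their intervals; the four cases add up to a multiple of $(A + D)(B + C)$.\<close>

lemma card_singular_matrices:
  fixes \<epsilon> :: real
  assumes "\<epsilon> > 0"
  shows "\<exists>K\<ge>1. \<forall>A B C D :: real. A \<ge> 1 \<longrightarrow> B \<ge> 1 \<longrightarrow> C \<ge> 1 \<longrightarrow> D \<ge> 1 \<longrightarrow>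
     finite (singular_matrices A B C D) \<and>
     real (card (singular_matrices A B C D)) \<le> K * ((A * D) powr (1 + \<epsilon>) + (A + D) * (B + C))"
proof -
  obtain K where K: "K \<ge> 1" "\<forall>(n::int) Q. n \<noteq> 0 \<longrightarrow> \<bar>real_of_int n\<bar> \<le> Q \<longrightarrow>
           real (card {(b, c). b * c = n}) \<le> K * Q powr \<epsilon>"
    using card_factorizations_powr[OF assms] by (elim exE conjE) (rule that)
  let ?I = "\<lambda>K. {k::int. \<bar>real_of_int k\<bar> \<le> K}"
  have cI: "real (card (?I L)) \<le> 3 * L" if "L \<ge> 1" for L
    using card_abs_le_real[of L] that by linarith
  have main: "finite S \<and> real (card S) \<le> (9 * K) * ((A * D) powr (1 + \<epsilon>) + (A + D) * (B + C))"
    if ge: "A \<ge> 1" "B \<ge> 1" "C \<ge> 1" "D \<ge> 1"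
    and S: "S = {((a, d), (b, c)). \<bar>real_of_int a\<bar> \<le> A \<and> \<bar>real_of_int d\<bar> \<le> D \<and>
                 \<bar>real_of_int b\<bar> \<le> B \<and> \<bar>real_of_int c\<bar> \<le> C \<and> a * d = b * c}" for A B C D S
  proof -
    define U where "U = {(a, d) \<in> ?I A \<times> ?I D. a * d \<noteq> 0}"
    define S1 where "S1 = Sigma U (\<lambda>(a, d). {(b, c). b * c = a * d})"
    define Z where "Z = ({0} \<times> ?I D) \<times> ({0} \<times> ?I C) \<union> ({0} \<times> ?I D) \<times> (?I B \<times> {0}) \<union>
        ((?I A \<times> {0}) \<times> ({0} \<times> ?I C) \<union> (?I A \<times> {0}) \<times> (?I B \<times> {0}))"
    have sub: "S \<subseteq> S1 \<union> Z"
    proof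
      fix s assume "s \<in> S"
      then obtain a b c d where s: "s = ((a, d), (b, c))" "\<bar>real_of_int a\<bar> \<le> A" "\<bar>real_of_int d\<bar> \<le> D"
          "\<bar>real_of_int b\<bar> \<le> B" "\<bar>real_of_int c\<bar> \<le> C" "a * d = b * c"
        unfolding S by blast
      show "s \<in> S1 \<union> Z"
      proof (cases "a * d = 0")
        case True
        then have "(a = 0 \<or> d = 0) \<and> (b = 0 \<or> c = 0)" using s(6) by (metis mult_eq_0_iff)
        then show ?thesis using s(1-5) unfolding Z_def by (simp, blast)
      next
        case False
        then have "a \<noteq> 0 \<and> d \<noteq> 0" by simp
        then show ?thesis using s unfolding S1_def U_def by simp
      qed
    qed
    have finU: "finite U"
      unfolding U_def by (rule finite_subset[of _ "?I A \<times> ?I D"]) auto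
    have finF: "finite ((\<lambda>(a, d). {(b, c). b * c = a * d}) ad)" if "ad \<in> U" for ad
      using that card_factorizations(1)[of "fst ad * snd ad"] by (simp add: U_def case_prod_unfold)
    have finS1: "finite S1"
      unfolding S1_def by (rule finite_SigmaI[OF finU finF])
    have finZ: "finite Z" unfolding Z_def by simp
    have "card U \<le> card (?I A \<times> ?I D)"
      unfolding U_def by (intro card_mono) auto
    then have "real (card U) \<le> real (card (?I A)) * real (card (?I D))"
      unfolding card_cartesian_product by (metis of_nat_le_iff of_nat_mult)
    also have "\<dots> \<le> (3 * A) * (3 * D)"
      using cI ge by (intro mult_mono) auto
    finally have cU: "real (card U) \<le> 9 * (A * D)" by simp
    have "card S1 = (\<Sum>ad\<in>U. card ((\<lambda>(a, d). {(b, c). b * c = a * d}) ad))"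
      unfolding S1_def by (rule card_SigmaI[OF finU]) (use finF in blast)
    then have "real (card S1) = (\<Sum>(a, d)\<in>U. real (card {(b, c). b * c = a * d}))"
      by (simp add: case_prod_unfold)
    also have "\<dots> \<le> (\<Sum>(a, d)\<in>U. K * (A * D) powr \<epsilon>)"
    proof (intro sum_mono, clarify)
      fix a d assume "(a, d) \<in> U"
      then have *: "\<bar>real_of_int a\<bar> \<le> A" "\<bar>real_of_int d\<bar> \<le> D" "a * d \<noteq> 0" by (auto simp: U_def)
      then have "\<bar>real_of_int (a * d)\<bar> \<le> A * D"
        unfolding of_int_mult abs_mult using ge by (intro mult_mono) simp_all
      then show "real (card {(b, c). b * c = a * d}) \<le> K * (A * D) powr \<epsilon>"
        by (rule K(2)[rule_format, OF *(3)])
    qed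
    also have "\<dots> = real (card U) * (K * (A * D) powr \<epsilon>)" by simp
    also have "\<dots> \<le> (9 * (A * D)) * (K * (A * D) powr \<epsilon>)"
      using cU K(1) by (intro mult_right_mono) auto
    also have "\<dots> = (9 * K) * (A * D) powr (1 + \<epsilon>)"
      using ge by (simp add: powr_add mult_ac)
    finally have cS1: "real (card S1) \<le> (9 * K) * (A * D) powr (1 + \<epsilon>)" .
    have "card Z \<le> (card (?I D) * card (?I C) + card (?I D) * card (?I B))
                + (card (?I A) * card (?I C) + card (?I A) * card (?I B))"
      unfolding Z_def
      by (rule order_trans[OF card_Un_le add_mono[OF order_trans[OF card_Un_le] order_trans[OF card_Un_le]]])
         (simp_all add: card_cartesian_product)
    then have "real (card Z) \<le> real ((card (?I D) * card (?I C) + card (?I D) * card (?I B))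
                + (card (?I A) * card (?I C) + card (?I A) * card (?I B)))"
      by (rule of_nat_mono)
    also have "\<dots> = (real (card (?I A)) + real (card (?I D))) * (real (card (?I B)) + real (card (?I C)))"
      by (simp add: algebra_simps)
    also have "\<dots> \<le> (3 * A + 3 * D) * (3 * B + 3 * C)"
      using cI ge by (intro mult_mono add_mono) auto
    also have "\<dots> = 9 * ((A + D) * (B + C))" by (simp add: algebra_simps)
    also have "\<dots> \<le> (9 * K) * ((A + D) * (B + C))"
      using K(1) ge by (intro mult_right_mono) auto
    finally have cZ: "real (card Z) \<le> (9 * K) * ((A + D) * (B + C))" .
    have "card S \<le> card (S1 \<union> Z)"
      by (rule card_mono[OF _ sub]) (simp add: finS1 finZ)
    also have "\<dots> \<le> card S1 + card Z" by (rule card_Un_le)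
    finally have "card S \<le> card S1 + card Z" .
    then have "real (card S) \<le> real (card S1) + real (card Z)" by linarith
    then show ?thesis
      using cS1 cZ sub finS1 finZ finite_subset[of S "S1 \<union> Z"] by (simp add: distrib_left)
  qed
  show ?thesis
  proof (rule exI[of _ "9 * K"], rule conjI, use K(1) in simp, intro allI impI)
    fix A B C D :: real
    assume ge: "1 \<le> A" "1 \<le> B" "1 \<le> C" "1 \<le> D"
    show "finite (singular_matrices A B C D) \<and> real (card (singular_matrices A B C D))
        \<le> 9 * K * ((A * D) powr (1 + \<epsilon>) + (A + D) * (B + C))"
      by (rule main[OF ge singular_matrices_def])
  qed
qed

section \<open>Lines in projective three-space and their lattices\<close>

definition dot :: "int ^ 'n \<Rightarrow> int ^ 'n \<Rightarrow> int" where
  "dot u v = (\<Sum>i\<in>UNIV. u $ i * v $ i)"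

definition wedge :: "int ^ 'n \<Rightarrow> int ^ 'n \<Rightarrow> int ^ 'n ^ 'n" where
  "wedge u v = (\<chi> i j. u $ i * v $ j - u $ j * v $ i)"

text \<open>The skew-symmetric matrix whose Pluecker coordinates are $x = (12, 13, 14)$ and
$y = (34, 42, 23)$.  With this ordering the Pfaffian is the product of $x$ and $y$, so that the
matrix has rank at most two iff \<^term>\<open>dot x y = 0\<close>, and exchanging $x$ with $y$ is Hodge duality.\<close>

definition skew :: "int ^ 3 \<Rightarrow> int ^ 3 \<Rightarrow> int ^ 4 ^ 4" where
  "skew x y = (\<chi> i j.
     if i = 1 \<and> j = 2 then x $ 1 else if i = 2 \<and> j = 1 then - x $ 1
     else if i = 1 \<and> j = 3 then x $ 2 else if i = 3 \<and> j = 1 then - x $ 2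
     else if i = 1 \<and> j = 4 then x $ 3 else if i = 4 \<and> j = 1 then - x $ 3
     else if i = 3 \<and> j = 4 then y $ 1 else if i = 4 \<and> j = 3 then - y $ 1
     else if i = 4 \<and> j = 2 then y $ 2 else if i = 2 \<and> j = 4 then - y $ 2
     else if i = 2 \<and> j = 3 then y $ 3 else if i = 3 \<and> j = 2 then - y $ 3
     else 0)"

lemma skew_nth:
  "skew x y $ 1 $ 1 = 0" "skew x y $ 1 $ 2 = x $ 1" "skew x y $ 1 $ 3 = x $ 2" "skew x y $ 1 $ 4 = x $ 3"
  "skew x y $ 2 $ 1 = - x $ 1" "skew x y $ 2 $ 2 = 0" "skew x y $ 2 $ 3 = y $ 3" "skew x y $ 2 $ 4 = - y $ 2"
  "skew x y $ 3 $ 1 = - x $ 2" "skew x y $ 3 $ 2 = - y $ 3" "skew x y $ 3 $ 3 = 0" "skew x y $ 3 $ 4 = y $ 1"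
  "skew x y $ 4 $ 1 = - x $ 3" "skew x y $ 4 $ 2 = y $ 2" "skew x y $ 4 $ 3 = - y $ 1" "skew x y $ 4 $ 4 = 0"
  by (simp_all add: skew_def)

text \<open>For a nonzero matrix \<^term>\<open>skew p q\<close> of rank two, that is $u v^T - v u^T$, these are the integer points of the plane
spanned by $u$ and $v$: the cone over a line in projective three-space.  The dual line gives the lattice
\<^term>\<open>line_lattice q p\<close> orthogonal to it.\<close>

definition line_lattice :: "int ^ 3 \<Rightarrow> int ^ 3 \<Rightarrow> (int ^ 4) set" where
  "line_lattice p q = {z. skew q p *v z = 0}"

text \<open>In other words the wedge product of $z$ with \<^term>\<open>skew p q\<close> vanishes.  The form with free
indices spares case distinctions over the coordinates later on.\<close>

lemma line_lattice_iff:
  "z \<in> line_lattice p q \<longleftrightarrow>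
     (\<forall>i j k. skew p q $ i $ j * z $ k + skew p q $ j $ k * z $ i + skew p q $ k $ i * z $ j = 0)"
  unfolding line_lattice_def
  by (simp add: vec_eq_iff forall_4 matrix_vector_mult_def sum_4 skew_nth) (auto simp: algebra_simps)

lemma skew_antisym: "skew x y $ i $ j = - skew x y $ j $ i"
  using exhaust_4[of i] exhaust_4[of j] by (auto simp: skew_nth)

lemma skew_transpose: "transpose (skew x y) = - skew x y"
  by (simp add: transpose_def vec_eq_iff skew_antisym[symmetric])

text \<open>This polarizes the statement that a skew matrix times its dual is minus its Pfaffian.  If two
lines meet, the right-hand side vanishes and the factors can be interchanged up to duality.\<close>

lemma skew_mult:
  "skew x y ** skew q p + skew p q ** skew y x = mat (- (dot x q + dot y p))"
  by (simp add: vec_eq_iff forall_4 matrix_matrix_mult_def sum_4 sum_3 skew_nth dot_def mat_def algebra_simps)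

lemma skew_mult_dual: "skew x y ** skew y x = mat (- dot x y)"
  by (simp add: vec_eq_iff forall_4 matrix_matrix_mult_def sum_4 sum_3 skew_nth dot_def mat_def algebra_simps)

lemma skew_eq_iff: "skew x y = skew x' y' \<longleftrightarrow> x = x' \<and> y = y'"
  by (auto simp: vec_eq_iff forall_3 forall_4 skew_nth)

lemma wedge_eq_skew: "\<exists>x y. wedge u v = skew x y \<and> dot x y = 0" for u v :: "int ^ 4"
proof (intro exI conjI)
  let ?w = "\<lambda>i j. wedge u v $ i $ j"
  let ?x = "vector [?w 1 2, ?w 1 3, ?w 1 4] :: int ^ 3"
  let ?y = "vector [?w 3 4, ?w 4 2, ?w 2 3] :: int ^ 3"
  show "wedge u v = skew ?x ?y"
    by (simp add: vec_eq_iff forall_4 wedge_def skew_nth algebra_simps)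
  show "dot ?x ?y = 0"
    by (simp add: wedge_def dot_def sum_3 algebra_simps)
qed

text \<open>The wedge product of $u$ and $v$ is a Pluecker vector of the plane that \<^term>\<open>skew p q\<close>
describes; the proportionality of the two is written without division.\<close>

lemma wedge_proportional:
  assumes "u \<in> line_lattice p q" and "v \<in> line_lattice p q"
  shows "wedge u v $ i $ j * skew p q $ k $ l = wedge u v $ k $ l * skew p q $ i $ j"
proof -
  let ?P = "skew p q"
  have u: "?P $ k $ l * u $ i + ?P $ l $ i * u $ k + ?P $ i $ k * u $ l = 0"
          "?P $ k $ l * u $ j + ?P $ l $ j * u $ k + ?P $ j $ k * u $ l = 0"
    using assms(1) by (auto simp: line_lattice_iff)
  have v: "?P $ i $ j * v $ l + ?P $ j $ l * v $ i + ?P $ l $ i * v $ j = 0"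
          "?P $ i $ j * v $ k + ?P $ j $ k * v $ i + ?P $ k $ i * v $ j = 0"
    using assms(2) by (auto simp: line_lattice_iff)
  have a: "?P $ l $ j = - ?P $ j $ l" "?P $ k $ i = - ?P $ i $ k"
    by (rule skew_antisym)+
  show ?thesis
    unfolding wedge_def vec_lambda_beta using u v a by algebra
qed

text \<open>Cramer's rule: all $3 \times 3$ minors of $u$, $v$, $w$ vanish, since by proportionality of
\<^term>\<open>wedge u v\<close> and \<^term>\<open>skew p q\<close> they are multiples of the equations for $w$.\<close>

lemma line_lattice_rank_two:
  assumes "u \<in> line_lattice p q" and "v \<in> line_lattice p q" and "w \<in> line_lattice p q" and "skew p q \<noteq> 0"
  shows "wedge u v $ i $ j *s w = wedge w v $ i $ j *s u + wedge u w $ i $ j *s v"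
proof -
  let ?P = "skew p q"
  obtain l m where lm: "?P $ l $ m \<noteq> 0"
    using assms(4) by (auto simp: vec_eq_iff)
  have "wedge u v $ i $ j * w $ k + wedge u v $ j $ k * w $ i + wedge u v $ k $ i * w $ j = 0" for k
  proof -
    have "?P $ l $ m * (wedge u v $ i $ j * w $ k + wedge u v $ j $ k * w $ i + wedge u v $ k $ i * w $ j)
        = wedge u v $ l $ m * (?P $ i $ j * w $ k + ?P $ j $ k * w $ i + ?P $ k $ i * w $ j)"
      using wedge_proportional[OF assms(1,2), of i j l m] wedge_proportional[OF assms(1,2), of j k l m]
        wedge_proportional[OF assms(1,2), of k i l m] by algebra
    also have "\<dots> = 0" using assms(3) by (simp add: line_lattice_iff)
    finally show ?thesis using lm by simp
  qed
  then show ?thesis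
    by (simp add: vec_eq_iff wedge_def algebra_simps)
qed

lemma matrix_vector_mult_lincomb:
  fixes M :: "int ^ 'n ^ 'm"
  shows "M *v (s *s u + t *s v) = s *s (M *v u) + t *s (M *v v)"
  by (simp add: vec_eq_iff matrix_vector_mult_def sum.distrib sum_distrib_left algebra_simps)

lemma line_lattice_lincomb:
  "u \<in> line_lattice p q \<Longrightarrow> v \<in> line_lattice p q \<Longrightarrow> s *s u + t *s v \<in> line_lattice p q"
  by (simp add: line_lattice_def matrix_vector_mult_lincomb)

lemma line_lattice_saturated:
  assumes "D *s z \<in> line_lattice p q" and "D \<noteq> 0"
  shows "z \<in> line_lattice p q"
proof -
  have "D *s (skew q p *v z) = 0"
    using assms(1) matrix_vector_mult_lincomb[of "skew q p" D z 0 z] by (simp add: line_lattice_def)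
  then show ?thesis using assms(2) by (simp add: line_lattice_def vec_eq_iff)
qed

lemma columns_in_line_lattice_iff: "(\<forall>j. column j M \<in> line_lattice p q) \<longleftrightarrow> skew q p ** M = 0"
  by (auto simp: line_lattice_def column_def vec_eq_iff matrix_matrix_mult_def matrix_vector_mult_def)

lemma dot_commute: "dot u v = dot v u"
  by (simp add: dot_def mult.commute)

lemma mat_zero: "mat 0 = 0"
  by (simp add: mat_def vec_eq_iff)

text \<open>Two columns of \<^term>\<open>skew p q\<close> itself do it: the columns $i$ and $j$ have the minor
$P_{ij}^2$ in the rows $i$ and $j$.\<close>

lemma ex_independent_in_line_lattice:
  assumes "dot p q = 0" and "skew p q \<noteq> 0"
  shows "\<exists>u\<in>line_lattice p q. \<exists>v\<in>line_lattice p q. wedge u v \<noteq> 0"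
proof -
  let ?P = "skew p q"
  obtain i j where ij: "?P $ i $ j \<noteq> 0"
    using assms(2) by (auto simp: vec_eq_iff)
  have "skew q p ** skew p q = 0"
    using skew_mult_dual[of q p] assms(1) by (simp add: dot_commute mat_zero)
  then have "column i ?P \<in> line_lattice p q" "column j ?P \<in> line_lattice p q"
    using columns_in_line_lattice_iff by blast+
  moreover have "wedge (column i ?P) (column j ?P) $ i $ j = (?P $ i $ j)\<^sup>2"
    using skew_antisym[of p q j i] skew_antisym[of p q i i] skew_antisym[of p q j j]
    by (simp add: wedge_def column_def power2_eq_square)
  ultimately show ?thesis
    using ij by (metis power_not_zero zero_index)
qed

lemma dot_lincomb_self:
  "dot (s *s u + t *s v) (s *s u + t *s v) = s\<^sup>2 * dot u u + 2 * (s * t * dot u v) + t\<^sup>2 * dot v v"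
  by (simp add: dot_def sum.distrib sum_distrib_left algebra_simps power2_eq_square)

lemma dot_self_nonneg: "0 \<le> dot u u"
  by (simp add: dot_def sum_nonneg)

lemma dot_self_eq_0_iff: "dot u u = 0 \<longleftrightarrow> u = 0"
  by (simp add: dot_def sum_nonneg_eq_0_iff vec_eq_iff)

lemma dot_self_pos_iff: "0 < dot u u \<longleftrightarrow> u \<noteq> 0"
  using dot_self_nonneg[of u] dot_self_eq_0_iff[of u] by linarith

lemma wedge_zero [simp]: "wedge 0 v = 0" "wedge u 0 = 0"
  by (simp_all add: wedge_def vec_eq_iff)

lemma wedge_lincomb:
  "wedge u (s *s u + t *s v) $ i $ j = t * wedge u v $ i $ j"
  "wedge (s *s u + t *s v) v $ i $ j = s * wedge u v $ i $ j"
  by (simp_all add: wedge_def algebra_simps)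

lemma independent_if_wedge_nonzero:
  assumes "wedge u v \<noteq> 0" and "s *s u + t *s v = 0"
  shows "s = 0 \<and> t = 0"
proof -
  obtain i j where "wedge u v $ i $ j \<noteq> 0"
    using assms(1) by (auto simp: vec_eq_iff)
  moreover have "t * wedge u v $ i $ j = 0" "s * wedge u v $ i $ j = 0"
    using wedge_lincomb(1)[of u s t v i j] wedge_lincomb(2)[of s u t v i j]
    unfolding assms(2) by simp_all
  ultimately show ?thesis by simp
qed

text \<open>A Lagrange-reduced basis.  By the two inequalities the lines through $a$ and $c$ enclose an angle of at
least sixty degrees, so lengths of combinations are governed by the lengths of their two parts.\<close>

definition reduced_basis :: "int ^ 3 \<Rightarrow> int ^ 3 \<Rightarrow> int ^ 4 \<Rightarrow> int ^ 4 \<Rightarrow> bool" where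
  "reduced_basis p q a c \<longleftrightarrow>
     a \<in> line_lattice p q \<and> c \<in> line_lattice p q \<and> wedge a c \<noteq> 0 \<and>
     dot a a \<le> dot c c \<and> 2 * \<bar>dot a c\<bar> \<le> dot a a \<and>
     (\<forall>z\<in>line_lattice p q. \<exists>s t. z = s *s a + t *s c)"

lemma nearest_multiple:
  fixes D x :: int
  assumes "D \<noteq> 0"
  shows "\<exists>k. 2 * \<bar>x - D * k\<bar> \<le> \<bar>D\<bar>"
proof -
  define E where "E = \<bar>D\<bar>"
  define k where "k = (2 * x + E) div (2 * E)"
  define r where "r = (2 * x + E) mod (2 * E)"
  have "2 * x + E = 2 * (E * k) + r"
    using div_mult_mod_eq[of "2 * x + E" "2 * E"] by (simp add: k_def r_def algebra_simps)
  moreover have "0 \<le> r" "r < 2 * E"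
    using assms by (simp_all add: E_def r_def)
  ultimately have "2 * (x - E * k) = r - E" "\<bar>r - E\<bar> \<le> E" by (simp_all add: abs_le_iff algebra_simps)
  then have "\<bar>2 * (x - E * k)\<bar> \<le> E" by metis
  then have "2 * \<bar>x - E * k\<bar> \<le> E"
    using abs_mult[of 2 "x - E * k"] by simp
  then have "2 * \<bar>x - D * (sgn D * k)\<bar> \<le> \<bar>D\<bar>"
    by (simp add: E_def abs_sgn mult.assoc)
  then show ?thesis by blast
qed

text \<open>Let $a$ be a shortest nonzero vector and $c$ a shortest one independent of $a$.  Subtracting the
nearest integer combination from a lattice vector leaves a vector $w$ whose coordinates are at most
$1/2$ in absolute value, hence $4|w|^2 \le 2|a|^2 + |c|^2 < 4|c|^2$.  So $w$ depends on $a$, and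
then $2|w| \le |a|$ forces $w = 0$.\<close>

lemma reduced_basis_exists:
  assumes "dot p q = 0" and "skew p q \<noteq> 0"
  shows "\<exists>a c. reduced_basis p q a c"
proof -
  define L where "L = line_lattice p q"
  obtain u v where uv: "u \<in> L" "v \<in> L" "wedge u v \<noteq> 0"
    using ex_independent_in_line_lattice[OF assms] by (auto simp: L_def)
  then have "u \<in> L \<and> u \<noteq> 0" by auto
  then obtain a where a: "a \<in> L" "a \<noteq> 0"
    and a_min: "\<And>z. z \<in> L \<Longrightarrow> z \<noteq> 0 \<Longrightarrow> nat (dot a a) \<le> nat (dot z z)"
    using ex_has_least_nat[of "\<lambda>z. z \<in> L \<and> z \<noteq> 0" u "\<lambda>z. nat (dot z z)"] by blast
  have a_min': "dot a a \<le> dot z z" if "z \<in> L" "z \<noteq> 0" for z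
    using a_min[OF that] dot_self_nonneg[of z] by linarith
  have "wedge a u \<noteq> 0 \<or> wedge a v \<noteq> 0"
  proof (rule ccontr)
    assume *: "\<not> ?thesis"
    obtain i j where ij: "wedge u v $ i $ j \<noteq> 0" using uv(3) by (auto simp: vec_eq_iff)
    have "wedge u a $ i $ j = - wedge a u $ i $ j" by (simp add: wedge_def algebra_simps)
    then have "wedge u v $ i $ j *s a = 0"
      using line_lattice_rank_two[of u p q v a i j] uv a assms(2) * by (simp add: L_def)
    then show False using ij a(2) by (auto simp: vec_eq_iff)
  qed
  then obtain c0 where "c0 \<in> L \<and> wedge a c0 \<noteq> 0" using uv by blast
  then obtain c where c: "c \<in> L" "wedge a c \<noteq> 0"
    and c_min: "\<And>z. z \<in> L \<Longrightarrow> wedge a z \<noteq> 0 \<Longrightarrow> nat (dot c c) \<le> nat (dot z z)"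
    using ex_has_least_nat[of "\<lambda>z. z \<in> L \<and> wedge a z \<noteq> 0" c0 "\<lambda>z. nat (dot z z)"] by blast
  have c_min': "dot c c \<le> dot z z" if "z \<in> L" "wedge a z \<noteq> 0" for z
    using c_min[OF that] dot_self_nonneg[of z] by linarith
  have c0: "c \<noteq> 0" using c(2) by auto
  have ac: "dot a a \<le> dot c c" using a_min' c(1) c0 by blast
  have comb: "s *s a + t *s c \<in> L" for s t
    using line_lattice_lincomb a(1) c(1) by (simp add: L_def)
  have w_comb: "wedge a (s *s a + 1 *s c) \<noteq> 0" for s
  proof -
    have "wedge a (s *s a + 1 *s c) = wedge a c"
      unfolding vec_eq_iff wedge_lincomb by simp
    then show ?thesis using c(2) by metis
  qed
  \<comment> \<open>neither $c + a$ nor $c - a$ is shorter than $c$\<close>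
  have red: "2 * \<bar>dot a c\<bar> \<le> dot a a"
    using c_min'[OF comb w_comb, of 1] c_min'[OF comb w_comb, of "-1"]
    unfolding dot_lincomb_self by simp
  have gen: "\<exists>s t. z = s *s a + t *s c" if z: "z \<in> L" for z
  proof -
    obtain i j where ij: "wedge a c $ i $ j \<noteq> 0" using c(2) by (auto simp: vec_eq_iff)
    define D where "D = wedge a c $ i $ j"
    have D: "D \<noteq> 0" using ij by (simp add: D_def)
    obtain k where k: "2 * \<bar>wedge z c $ i $ j - D * k\<bar> \<le> \<bar>D\<bar>"
      using nearest_multiple[OF D] by blast
    obtain l where l: "2 * \<bar>wedge a z $ i $ j - D * l\<bar> \<le> \<bar>D\<bar>"
      using nearest_multiple[OF D] by blast
    \<comment> \<open>$s/D$ and $t/D$ are the coordinates of the remainder $w$\<close>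
    define s where "s = wedge z c $ i $ j - D * k"
    define t where "t = wedge a z $ i $ j - D * l"
    define w where "w = z - (k *s a + l *s c)"
    have "D *s z = wedge z c $ i $ j *s a + wedge a z $ i $ j *s c"
      unfolding D_def using line_lattice_rank_two[of a p q c z] a c z assms(2) by (simp add: L_def)
    then have Dw: "D *s w = s *s a + t *s c"
      by (simp add: w_def s_def t_def vec_eq_iff algebra_simps)
    have wL: "w \<in> L"
    proof -
      have "w = 1 *s z + (-1) *s (k *s a + l *s c)"
        by (simp add: w_def vec_eq_iff)
      then show ?thesis
        using line_lattice_lincomb z comb[of k l] unfolding L_def by metis
    qed
    have st: "2 * \<bar>s\<bar> \<le> \<bar>D\<bar>" "2 * \<bar>t\<bar> \<le> \<bar>D\<bar>"
      using k l by (simp_all add: s_def t_def)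
    have sq: "4 * s\<^sup>2 \<le> D\<^sup>2" "4 * t\<^sup>2 \<le> D\<^sup>2"
      using power_mono[OF st(1), of 2] power_mono[OF st(2), of 2]
      by (simp_all add: power_mult_distrib)
    have len: "D\<^sup>2 * dot w w = s\<^sup>2 * dot a a + 2 * (s * t * dot a c) + t\<^sup>2 * dot c c"
    proof -
      have "dot (D *s w) (D *s w) = D\<^sup>2 * dot w w"
        by (simp add: dot_def sum_distrib_left power2_eq_square algebra_simps)
      then show ?thesis by (simp add: Dw dot_lincomb_self)
    qed
    have "4 * (D\<^sup>2 * dot w w) \<le> D\<^sup>2 * (2 * dot a a + dot c c)"
    proof -
      have "(2 * \<bar>s\<bar>) * (2 * \<bar>t\<bar>) \<le> \<bar>D\<bar> * \<bar>D\<bar>"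
        using mult_mono[OF st] by simp
      then have "((2 * \<bar>s\<bar>) * (2 * \<bar>t\<bar>)) * (2 * \<bar>dot a c\<bar>) \<le> (\<bar>D\<bar> * \<bar>D\<bar>) * dot a a"
        by (rule mult_mono) (use red in simp_all)
      moreover have "8 * (s * t * dot a c) \<le> ((2 * \<bar>s\<bar>) * (2 * \<bar>t\<bar>)) * (2 * \<bar>dot a c\<bar>)"
        using abs_ge_self[of "s * t * dot a c"] by (simp add: abs_mult)
      ultimately have "8 * (s * t * dot a c) \<le> D\<^sup>2 * dot a a"
        by (simp add: power2_eq_square)
      moreover have "4 * s\<^sup>2 * dot a a \<le> D\<^sup>2 * dot a a" "4 * t\<^sup>2 * dot c c \<le> D\<^sup>2 * dot c c"
        using sq by (auto intro: mult_right_mono dot_self_nonneg)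
      ultimately show ?thesis unfolding len by (simp add: algebra_simps)
    qed
    then have "D\<^sup>2 * (4 * dot w w) \<le> D\<^sup>2 * (2 * dot a a + dot c c)"
      by (simp add: algebra_simps)
    then have "4 * dot w w \<le> 2 * dot a a + dot c c"
      using D by (simp add: mult_le_cancel_left_pos)
    then have "dot w w < dot c c"
      using ac c0 dot_self_pos_iff[of c] by linarith
    then have "wedge a w = 0" using c_min'[OF wL] by fastforce
    then have "wedge a (D *s w) $ i $ j = 0"
      by (simp add: wedge_def vec_eq_iff algebra_simps)
    then have t0: "t = 0"
      unfolding Dw wedge_lincomb using ij by simp
    have "4 * (D\<^sup>2 * dot w w) \<le> D\<^sup>2 * dot a a"
      using len t0 mult_right_mono[OF sq(1) dot_self_nonneg[of a]] by simp
    then have "D\<^sup>2 * (4 * dot w w) \<le> D\<^sup>2 * dot a a"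
      by (simp add: algebra_simps)
    then have "4 * dot w w \<le> dot a a"
      using D by (simp add: mult_le_cancel_left_pos)
    then have "w = 0"
      using a_min'[OF wL] dot_self_pos_iff[of w] by fastforce
    then show ?thesis by (auto simp: w_def)
  qed
  show ?thesis
    using a c ac red gen unfolding reduced_basis_def L_def by blast
qed

text \<open>Over the rationals this holds because both matrices belong to the same plane; the point is that the
factor is an integer.  Writing the columns of the left-hand side in the basis gives integer vectors
$r$ and $s$ which are proportional to $c$ and $a$ with opposite factors.  The vector $s$ lies in
the lattice, and it is a multiple of the basis vector $a$, so its factor is an integer.\<close>

lemma skew_eq_multiple_wedge:
  assumes B: "reduced_basis p q a c" and Y: "skew q p ** skew x y = 0"
  shows "\<exists>k. \<forall>i j. skew x y $ i $ j = k * wedge a c $ i $ j"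
proof -
  let ?Y = "skew x y"
  have "\<forall>j. \<exists>s t. column j ?Y = s *s a + t *s c"
    using B Y columns_in_line_lattice_iff unfolding reduced_basis_def by blast
  then obtain r s where rs: "\<And>j. column j ?Y = r j *s a + s j *s c" by metis
  have Yij: "?Y $ i $ j = r j * a $ i + s j * c $ i" for i j
    using arg_cong[OF rs[of j], of "\<lambda>v. v $ i"] by (simp add: column_def)
  have anti: "r j * a $ i + s j * c $ i + (r i * a $ j + s i * c $ j) = 0" for i j
    using skew_antisym[of x y i j] by (simp add: Yij)
  have diag: "r i * a $ i + s i * c $ i = 0" for i
    using anti[of i i] by simp
  obtain i j where ij: "wedge a c $ i $ j \<noteq> 0"
    using B by (auto simp: reduced_basis_def vec_eq_iff)
  define D where "D = a $ i * c $ j - a $ j * c $ i"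
  have D: "D \<noteq> 0" using ij by (simp add: D_def wedge_def)
  define m where "m = ?Y $ i $ j"
  have m: "m = r j * a $ i + s j * c $ i" by (simp add: m_def Yij)
  \<comment> \<open>the claim $Dr = mc$, $Ds = -ma$, at first in the coordinates $j$ and $i$ only\<close>
  have rj: "D * r j = m * c $ j" and sj: "D * s j = - m * a $ j"
    using diag[of j] m D_def by algebra+
  have ri: "D * r i = m * c $ i" and si: "D * s i = - m * a $ i"
    using diag[of i] anti[of i j] m D_def by algebra+
  have "D * (c $ i * r j - c $ j * r i) = 0" "D * (c $ i * s j - c $ j * s i - m) = 0"
       "D * (a $ i * r j - a $ j * r i - m) = 0" "D * (a $ i * s j - a $ j * s i) = 0"
    using rj sj ri si D_def by algebra+
  then have z: "c $ i * r j - c $ j * r i = 0" "c $ i * s j - c $ j * s i - m = 0"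
     "a $ i * r j - a $ j * r i - m = 0" "a $ i * s j - a $ j * s i = 0"
    using D by simp_all
  have r: "D * r k = m * c $ k" and s: "D * s k = - m * a $ k" for k
    using z anti[of i k] anti[of j k] D_def by algebra+
  define sv where "sv = (\<chi> k. s k)"
  have "D *s sv = (-m) *s a + 0 *s c"
    by (simp add: vec_eq_iff sv_def s)
  moreover have "a \<in> line_lattice p q" "c \<in> line_lattice p q" using B by (auto simp: reduced_basis_def)
  ultimately have "D *s sv \<in> line_lattice p q" using line_lattice_lincomb by metis
  then have "sv \<in> line_lattice p q" using D line_lattice_saturated by blast
  then obtain k l where kl: "sv = k *s a + l *s c"
    using B by (auto simp: reduced_basis_def)
  have "(D * k + m) *s a + (D * l) *s c = 0"
    using \<open>D *s sv = (-m) *s a + 0 *s c\<close> unfolding kl by (simp add: vec_eq_iff algebra_simps)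
  then have "D * k + m = 0"
    using B independent_if_wedge_nonzero unfolding reduced_basis_def by blast
  then have km: "m = - (D * k)" by simp
  have "D * (r n + k * c $ n) = 0" "D * (s n - k * a $ n) = 0" for n
    using r[of n] s[of n] km by algebra+
  then have "r n = - (k * c $ n)" "s n = k * a $ n" for n
    using D by (simp_all add: add_eq_0_iff2)
  then have "?Y $ n $ n' = (- k) * wedge a c $ n $ n'" for n n'
    by (simp add: Yij wedge_def algebra_simps)
  then show ?thesis by blast
qed

text \<open>The equations for $z$, contracted with $b$, express $P_{ij} (b \cdot z)$ through $P b = 0$.\<close>

lemma line_lattice_orthogonal:
  assumes "z \<in> line_lattice p q" and "b \<in> line_lattice q p" and "skew p q \<noteq> 0"
  shows "dot b z = 0"
proof -
  let ?P = "skew p q"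
  obtain i j where ij: "?P $ i $ j \<noteq> 0"
    using assms(3) by (auto simp: vec_eq_iff)
  have 0: "(\<Sum>k\<in>UNIV. ?P $ l $ k * b $ k) = 0" for l
    using assms(2) by (simp add: line_lattice_def matrix_vector_mult_def vec_eq_iff)
  have "?P $ i $ j * dot b z = (\<Sum>k\<in>UNIV. b $ k * (?P $ i $ j * z $ k))"
    by (simp add: dot_def sum_distrib_left mult_ac)
  also have "\<dots> = (\<Sum>k\<in>UNIV. z $ j * (?P $ i $ k * b $ k) - z $ i * (?P $ j $ k * b $ k))"
  proof (rule sum.cong)
    fix k
    have "?P $ i $ j * z $ k + ?P $ j $ k * z $ i + ?P $ k $ i * z $ j = 0"
      using assms(1) by (simp add: line_lattice_iff)
    then show "b $ k * (?P $ i $ j * z $ k) = z $ j * (?P $ i $ k * b $ k) - z $ i * (?P $ j $ k * b $ k)"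
      using skew_antisym[of p q k i] by algebra
  qed simp
  also have "\<dots> = 0"
    by (simp add: sum_subtractf 0 flip: sum_distrib_left)
  finally show ?thesis using ij by simp
qed

text \<open>This is where the incidence of the two lines enters: the matrix of a line that meets $(p, q)$ maps the
lattice orthogonal to $(p, q)$ back into the lattice of $(p, q)$.\<close>

lemma skew_maps_line_lattice:
  assumes "b \<in> line_lattice q p" and "dot x q + dot y p = 0"
  shows "skew x y *v b \<in> line_lattice p q"
proof -
  have "skew q p ** skew x y + skew y x ** skew p q = 0"
    using skew_mult[of q p x y] assms(2)
    by (simp add: dot_commute[of q] dot_commute[of p] mat_zero)
  then have "(skew q p ** skew x y) *v b + (skew y x ** skew p q) *v b = 0"
    by (metis matrix_vector_mult_add_rdistrib matrix_vector_mult_0)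
  moreover have "(skew y x ** skew p q) *v b = 0"
    using assms(1) by (simp add: line_lattice_def flip: matrix_vector_mul_assoc)
  ultimately show ?thesis
    by (simp add: line_lattice_def matrix_vector_mul_assoc)
qed

lemma skew_pluecker:
  assumes "dot x y = 0"
  shows "skew x y $ i $ k * skew x y $ j $ l - skew x y $ j $ k * skew x y $ i $ l
       = skew x y $ i $ j * skew x y $ k $ l"
proof -
  have "x $ 1 * y $ 1 + x $ 2 * y $ 2 + x $ 3 * y $ 3 = 0"
    using assms by (simp add: dot_def sum_3)
  then have "\<forall>i j k l. skew x y $ i $ k * skew x y $ j $ l - skew x y $ j $ k * skew x y $ i $ l
       = skew x y $ i $ j * skew x y $ k $ l"
    unfolding forall_4 skew_nth by (simp add: algebra_simps)
  then show ?thesis by blast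
qed

text \<open>A form of the Pluecker relation: a skew matrix of rank two maps $b$ and $d$ to parallel vectors
whenever its bilinear form vanishes at $(b, d)$.\<close>

lemma wedge_skew_image:
  assumes "dot x y = 0"
  shows "wedge (skew x y *v b) (skew x y *v d) $ i $ j = dot b (skew x y *v d) * skew x y $ i $ j"
proof -
  let ?X = "skew x y"
  have "wedge (?X *v b) (?X *v d) $ i $ j
      = (\<Sum>k\<in>UNIV. \<Sum>l\<in>UNIV. b $ k * d $ l * (?X $ i $ k * ?X $ j $ l - ?X $ j $ k * ?X $ i $ l))"
    by (simp add: wedge_def matrix_vector_mult_def sum_product sum_subtractf[symmetric] algebra_simps)
  also have "\<dots> = (\<Sum>k\<in>UNIV. \<Sum>l\<in>UNIV. b $ k * d $ l * (?X $ i $ j * ?X $ k $ l))"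
    by (simp only: skew_pluecker[OF assms])
  also have "\<dots> = dot b (?X *v d) * ?X $ i $ j"
    by (simp add: dot_def matrix_vector_mult_def sum_distrib_left sum_distrib_right mult_ac)
  finally show ?thesis .
qed

section \<open>Counting lines of bounded height\<close>

definition int_box :: "nat \<Rightarrow> (int ^ 'n) set" where
  "int_box R = {x. \<forall>i. \<bar>x $ i\<bar> \<le> int R}"

text \<open>These are the Pluecker vectors of height at most $R$, zero included.  The coordinates other than
$x_1$ and $y_1$ determine $x_1 y_1$.  If this number is nonzero, it has few factorizations; if it is
zero, those four coordinates form, up to a sign, a singular $2 \times 2$ matrix, and one of $x_1$,
$y_1$ is free.\<close>

lemma card_isotropic:
  fixes \<epsilon> :: real
  assumes "\<epsilon> > 0"
  shows "\<exists>K\<ge>1. \<forall>R::nat. R \<ge> 1 \<longrightarrow>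
    finite {(x :: int ^ 3, y). x \<in> int_box R \<and> y \<in> int_box R \<and> dot x y = 0} \<and>
    real (card {(x :: int ^ 3, y). x \<in> int_box R \<and> y \<in> int_box R \<and> dot x y = 0}) \<le> K * real R powr (4 + \<epsilon>)"
proof -
  have e2: "\<epsilon> / 2 > 0" using assms by simp
  obtain K1 where K1: "K1 \<ge> 1" "\<forall>(n::int) Q. n \<noteq> 0 \<longrightarrow> \<bar>real_of_int n\<bar> \<le> Q \<longrightarrow>
           real (card {(b, c). b * c = n}) \<le> K1 * Q powr (\<epsilon> / 2)"
    using card_factorizations_powr[OF e2] by (elim exE conjE) (rule that)
  obtain K2 where K2: "K2 \<ge> 1" "\<forall>A B C D :: real. A \<ge> 1 \<longrightarrow> B \<ge> 1 \<longrightarrow> C \<ge> 1 \<longrightarrow> D \<ge> 1 \<longrightarrow>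
     (finite (singular_matrices A B C D) \<and> real (card (singular_matrices A B C D)) \<le> K2 * ((A * D) powr (1 + \<epsilon> / 2) + (A + D) * (B + C)))"
    using card_singular_matrices[OF e2] by (elim exE conjE) (rule that)
  define K where "K = 81 * (K1 * 2 powr (\<epsilon> / 2)) + 30 * K2"
  have main: "finite S \<and> real (card S) \<le> K * real R powr (4 + \<epsilon>)"
    if R: "R \<ge> 1" and S: "S = {(x :: int ^ 3, y). x \<in> int_box R \<and> y \<in> int_box R \<and> dot x y = 0}" for R S
  proof -
    define r where "r = real R"
    have r: "r \<ge> 1" using R by (simp add: r_def)
    let ?I = "{k::int. \<bar>real_of_int k\<bar> \<le> r}"
    define W where "W = singular_matrices r r r r"
    define V where "V = {((a, d), (b, c)) \<in> (?I \<times> ?I) \<times> (?I \<times> ?I). b * c - a * d \<noteq> 0}"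
    define F where "F = (\<lambda>((a, d), (b, c)). {(e, f). e * f = (b * c - a * d :: int)})"
    define \<phi> where "\<phi> = (\<lambda>(x :: int ^ 3, y :: int ^ 3). (((x $ 2, y $ 2), (- x $ 3, y $ 3)), (x $ 1, y $ 1)))"
    have inj: "inj_on \<phi> S"
      by (auto simp: inj_on_def \<phi>_def vec_eq_iff forall_3)
    have finV: "finite V"
      unfolding V_def by (rule finite_subset[of _ "(?I \<times> ?I) \<times> (?I \<times> ?I)"]) auto
    have cI: "real (card ?I) \<le> 3 * r" using card_abs_le_real[of r] r by linarith
    have cV: "real (card V) \<le> 81 * r ^ 4"
    proof -
      have "card V \<le> card ((?I \<times> ?I) \<times> (?I \<times> ?I))"
        unfolding V_def by (intro card_mono) auto
      also have "\<dots> = card ?I ^ 4" by (simp add: card_cartesian_product power4_eq_xxxx)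
      finally have "real (card V) \<le> real (card ?I) ^ 4"
        by (metis of_nat_le_iff of_nat_power)
      also have "\<dots> \<le> (3 * r) ^ 4" using cI by (intro power_mono) auto
      finally show ?thesis by (simp add: power_mult_distrib)
    qed
    have finF: "finite (F v)" if "v \<in> V" for v
    proof -
      obtain a b c d where v: "v = ((a, d), (b, c))" by (metis surj_pair)
      show ?thesis using that card_factorizations(1)[of "b * c - a * d"]
        unfolding V_def F_def v by simp
    qed
    have cF: "real (card (F v)) \<le> K1 * 2 powr (\<epsilon> / 2) * r powr \<epsilon>" if "v \<in> V" for v
    proof -
      obtain a b c d where v: "v = ((a, d), (b, c))" by (metis surj_pair)
      have le: "\<bar>real_of_int a\<bar> \<le> r" "\<bar>real_of_int b\<bar> \<le> r" "\<bar>real_of_int c\<bar> \<le> r" "\<bar>real_of_int d\<bar> \<le> r"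
        and ne: "b * c - a * d \<noteq> 0"
        using that unfolding v V_def by auto
      have "\<bar>real_of_int b\<bar> * \<bar>real_of_int c\<bar> \<le> r * r" "\<bar>real_of_int a\<bar> * \<bar>real_of_int d\<bar> \<le> r * r"
        using le r by (auto intro!: mult_mono)
      then have "\<bar>real_of_int (b * c - a * d)\<bar> \<le> 2 * r\<^sup>2"
        using abs_triangle_ineq4[of "real_of_int (b * c)" "real_of_int (a * d)"]
        by (simp add: abs_mult power2_eq_square)
      then have "real (card (F v)) \<le> K1 * (2 * r\<^sup>2) powr (\<epsilon> / 2)"
        using K1(2) ne unfolding F_def v by simp
      also have "(2 * r\<^sup>2) powr (\<epsilon> / 2) = 2 powr (\<epsilon> / 2) * r powr \<epsilon>"
        using r by (simp add: powr_mult powr_powr flip: powr_numeral)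
      finally show ?thesis by simp
    qed
    have cS1: "real (card (Sigma V F)) \<le> 81 * (K1 * 2 powr (\<epsilon> / 2)) * r powr (4 + \<epsilon>)"
    proof -
      have "real (card (Sigma V F)) = (\<Sum>v\<in>V. real (card (F v)))"
        by (subst card_SigmaI[OF finV]) (use finF in auto)
      also have "\<dots> \<le> (\<Sum>v\<in>V. K1 * 2 powr (\<epsilon> / 2) * r powr \<epsilon>)"
        by (intro sum_mono cF)
      also have "\<dots> = real (card V) * (K1 * 2 powr (\<epsilon> / 2) * r powr \<epsilon>)" by simp
      also have "\<dots> \<le> (81 * r ^ 4) * (K1 * 2 powr (\<epsilon> / 2) * r powr \<epsilon>)"
        using cV K1(1) by (intro mult_right_mono) auto
      also have "\<dots> = 81 * (K1 * 2 powr (\<epsilon> / 2)) * r powr (4 + \<epsilon>)"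
        using r by (simp add: powr_add mult_ac)
      finally show ?thesis .
    qed
    define Z where "Z = W \<times> (({0} \<times> ?I) \<union> (?I \<times> {0}))"
    have W: "finite W" "real (card W) \<le> 5 * K2 * r powr (2 + \<epsilon>)"
    proof -
      have "real (card W) \<le> K2 * ((r * r) powr (1 + \<epsilon> / 2) + (r + r) * (r + r))"
        using K2(2) r unfolding W_def by blast
      also have "(r * r) powr (1 + \<epsilon> / 2) = r powr (2 + \<epsilon>)"
        using r by (simp add: powr_mult flip: powr_add)
      also have "(r + r) * (r + r) = 4 * r powr 2"
        using r by (simp add: power2_eq_square)
      also have "K2 * (r powr (2 + \<epsilon>) + 4 * r powr 2) \<le> K2 * (r powr (2 + \<epsilon>) + 4 * r powr (2 + \<epsilon>))"
        using K2(1) r assms by (intro mult_left_mono add_left_mono powr_mono) auto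
      finally show "real (card W) \<le> 5 * K2 * r powr (2 + \<epsilon>)" by simp
      show "finite W" using K2(2) r unfolding W_def by blast
    qed
    have cZ: "real (card Z) \<le> 30 * K2 * r powr (4 + \<epsilon>)"
    proof -
      have "card (({0} \<times> ?I) \<union> (?I \<times> {0})) \<le> card ({0::int} \<times> ?I) + card (?I \<times> {0::int})"
        by (rule card_Un_le)
      also have "\<dots> = 2 * card ?I" by (simp add: card_cartesian_product)
      finally have "real (card (({0} \<times> ?I) \<union> (?I \<times> {0}))) \<le> 6 * r" using cI by linarith
      then have "real (card Z) \<le> (5 * K2 * r powr (2 + \<epsilon>)) * (6 * r)"
        unfolding Z_def card_cartesian_product of_nat_mult using W by (intro mult_mono) auto
      also have "\<dots> = 30 * K2 * r powr (3 + \<epsilon>)"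
      proof -
        have "r powr (3 + \<epsilon>) = r powr (2 + \<epsilon>) * r powr 1" unfolding powr_add[symmetric] by simp
        then show ?thesis using r by simp
      qed
      also have "\<dots> \<le> 30 * K2 * r powr (4 + \<epsilon>)"
        using r K2(1) by (intro mult_left_mono powr_mono) auto
      finally show ?thesis .
    qed
    have finZ: "finite Z" unfolding Z_def using W(1) by simp
    have fin1: "finite (Sigma V F)" by (rule finite_SigmaI[OF finV finF])
    have sub: "\<phi> ` S \<subseteq> Sigma V F \<union> Z"
    proof (rule image_subsetI)
      fix s assume "s \<in> S"
      then obtain x y where s: "s = (x, y)" "(x, y) \<in> S" by (metis surj_pair)
      have box: "\<bar>x $ i\<bar> \<le> int R" "\<bar>y $ i\<bar> \<le> int R" for i
        using s(2) by (auto simp: S int_box_def)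
      have 0: "x $ 1 * y $ 1 + x $ 2 * y $ 2 + x $ 3 * y $ 3 = 0"
        using s(2) by (simp add: S dot_def sum_3)
      have bx: "\<bar>real_of_int (x $ i)\<bar> \<le> r" "\<bar>real_of_int (y $ i)\<bar> \<le> r" for i
        using box[of i] unfolding r_def by linarith+
      have eq: "x $ 1 * y $ 1 = (- x $ 3) * y $ 3 - x $ 2 * y $ 2" using 0 by linarith
      show "\<phi> s \<in> Sigma V F \<union> Z"
      proof (cases "x $ 1 * y $ 1 = 0")
        case True
        then have "x $ 2 * y $ 2 = (- x $ 3) * y $ 3" using eq by linarith
        moreover have "x $ 1 = 0 \<or> y $ 1 = 0" using True by simp
        ultimately have "\<phi> s \<in> Z"
          unfolding Z_def W_def singular_matrices_def \<phi>_def s(1) using bx by auto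
        then show ?thesis by simp
      next
        case False
        then show ?thesis
          unfolding V_def F_def \<phi>_def s(1) using bx eq by simp
      qed
    qed
    have finS: "finite S"
      using sub fin1 finZ inj by (meson finite_UnI finite_imageD finite_subset)
    have "card S = card (\<phi> ` S)" using inj by (simp add: card_image)
    also have "\<dots> \<le> card (Sigma V F \<union> Z)" by (rule card_mono[OF _ sub]) (simp add: fin1 finZ)
    also have "\<dots> \<le> card (Sigma V F) + card Z" by (rule card_Un_le)
    finally have "real (card S) \<le> real (card (Sigma V F)) + real (card Z)" by linarith
    also have "\<dots> \<le> K * r powr (4 + \<epsilon>)"
      using cS1 cZ by (simp add: K_def distrib_right)
    finally show ?thesis using finS by (simp add: r_def)
  qed
  have "K \<ge> 1" using K1(1) K2(1) by (simp add: K_def add_nonneg_pos order_trans[of 1 "30 * K2"])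
  then show ?thesis
    using main[OF _ refl] by blast
qed

section \<open>Lengths of reduced bases\<close>

definition sq_norm :: "int ^ 4 ^ 4 \<Rightarrow> int" where
  "sq_norm M = (\<Sum>i\<in>UNIV. \<Sum>j\<in>UNIV. (M $ i $ j)\<^sup>2)"

lemma sq_norm_skew_dual: "sq_norm (skew y x) = sq_norm (skew x y)"
  by (simp add: sq_norm_def sum_4 skew_nth algebra_simps)

lemma sq_norm_wedge: "sq_norm (wedge a c) = 2 * (dot a a * dot c c - (dot a c)\<^sup>2)"
  by (simp add: sq_norm_def wedge_def dot_def sum_4 power2_eq_square algebra_simps)

lemma sq_norm_multiple:
  assumes "\<And>i j. M $ i $ j = k * N $ i $ j"
  shows "sq_norm M = k\<^sup>2 * sq_norm N"
  by (simp add: sq_norm_def assms power_mult_distrib sum_distrib_left)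

lemma sq_norm_eq_0_iff: "sq_norm M = 0 \<longleftrightarrow> M = 0"
proof
  assume "sq_norm M = 0"
  then have "\<forall>i. (\<Sum>j\<in>UNIV. (M $ i $ j)\<^sup>2) = 0"
    unfolding sq_norm_def by (subst (asm) sum_nonneg_eq_0_iff) (simp_all add: sum_nonneg)
  then have "\<forall>i j. M $ i $ j = 0"
    by (subst (asm) sum_nonneg_eq_0_iff) simp_all
  then show "M = 0" by (simp add: vec_eq_iff)
qed (simp add: sq_norm_def)

lemma sq_norm_nonneg: "0 \<le> sq_norm M"
  by (simp add: sq_norm_def sum_nonneg)

lemma sq_norm_skew_le:
  assumes "x \<in> int_box R" and "y \<in> int_box R"
  shows "sq_norm (skew x y) \<le> 16 * (int R)\<^sup>2"
proof -
  have "(skew x y $ i $ j)\<^sup>2 \<le> (int R)\<^sup>2" for i j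
  proof -
    have "\<bar>skew x y $ i $ j\<bar> \<le> int R"
      using assms exhaust_4[of i] exhaust_4[of j] by (auto simp: int_box_def skew_nth)
    then show ?thesis by (metis abs_ge_zero power2_abs power_mono)
  qed
  then have "sq_norm (skew x y) \<le> (\<Sum>i\<in>(UNIV::4 set). \<Sum>j\<in>(UNIV::4 set). (int R)\<^sup>2)"
    unfolding sq_norm_def by (intro sum_mono)
  then show ?thesis by simp
qed

lemma dot_matrix_image_le:
  fixes M :: "int ^ 4 ^ 4"
  shows "dot (M *v b) (M *v b) \<le> sq_norm M * dot b b"
proof -
  have "((M *v b) $ i)\<^sup>2 \<le> (\<Sum>j\<in>UNIV. (M $ i $ j)\<^sup>2) * dot b b" for i
  proof -
    have "((M *v b) $ i)\<^sup>2 \<le> (\<Sum>j\<in>UNIV. (M $ i $ j)\<^sup>2) * (\<Sum>j\<in>UNIV. (b $ j)\<^sup>2)"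
    proof -
      have "(\<Sum>j\<in>UNIV. real_of_int (M $ i $ j) * real_of_int (b $ j))\<^sup>2
          \<le> (\<Sum>j\<in>UNIV. (real_of_int (M $ i $ j))\<^sup>2) * (\<Sum>j\<in>UNIV. (real_of_int (b $ j))\<^sup>2)"
        by (rule Cauchy_Schwarz_ineq_sum)
      then have "real_of_int (((M *v b) $ i)\<^sup>2)
          \<le> real_of_int ((\<Sum>j\<in>UNIV. (M $ i $ j)\<^sup>2) * (\<Sum>j\<in>UNIV. (b $ j)\<^sup>2))"
        by (simp add: matrix_vector_mult_def)
      then show ?thesis by (rule of_int_le_iff[THEN iffD1])
    qed
    then show ?thesis by (simp add: dot_def power2_eq_square)
  qed
  then have "(\<Sum>i\<in>UNIV. ((M *v b) $ i)\<^sup>2) \<le> (\<Sum>i\<in>UNIV. (\<Sum>j\<in>UNIV. (M $ i $ j)\<^sup>2) * dot b b)"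
    by (intro sum_mono)
  then show ?thesis
    by (simp add: dot_def sq_norm_def power2_eq_square sum_distrib_right)
qed

lemma reduced_basis_pos:
  assumes "reduced_basis p q a c"
  shows "1 \<le> dot a a" and "dot a a \<le> dot c c"
proof -
  have "a \<noteq> 0" using assms by (auto simp: reduced_basis_def)
  then show "1 \<le> dot a a" using dot_self_pos_iff[of a] by linarith
  show "dot a a \<le> dot c c" using assms by (simp add: reduced_basis_def)
qed

lemma reduced_basis_gram:
  assumes "reduced_basis p q a c"
  shows "4 * (dot a c)\<^sup>2 \<le> dot a a * dot c c"
proof -
  have "(2 * \<bar>dot a c\<bar>)\<^sup>2 \<le> (dot a a)\<^sup>2"
    using assms by (intro power_mono) (auto simp: reduced_basis_def)
  also have "\<dots> \<le> dot a a * dot c c"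
    using reduced_basis_pos[OF assms] by (simp add: power2_eq_square mult_left_mono)
  finally show ?thesis by (simp add: power_mult_distrib)
qed

lemma sq_norm_wedge_reduced:
  assumes "reduced_basis p q a c"
  shows "3 * (dot a a * dot c c) \<le> 2 * sq_norm (wedge a c)"
    and "sq_norm (wedge a c) \<le> 2 * (dot a a * dot c c)"
  using reduced_basis_gram[OF assms] by (simp_all add: sq_norm_wedge)

text \<open>Near-orthogonality of a reduced basis: neither part of a combination is much longer than the
combination.\<close>

lemma reduced_coefficients_le:
  assumes "reduced_basis p q a c"
  shows "s\<^sup>2 * dot a a \<le> 2 * dot (s *s a + t *s c) (s *s a + t *s c)"
    and "t\<^sup>2 * dot c c \<le> 2 * dot (s *s a + t *s c) (s *s a + t *s c)"
proof -
  let ?A = "dot a a" and ?C = "dot c c"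
  note pos = reduced_basis_pos[OF assms]
  have "\<bar>s * t\<bar> * (2 * \<bar>dot a c\<bar>) \<le> \<bar>s * t\<bar> * ?A"
    using assms by (intro mult_left_mono) (auto simp: reduced_basis_def)
  moreover have "\<bar>2 * (s * t * dot a c)\<bar> = \<bar>s * t\<bar> * (2 * \<bar>dot a c\<bar>)"
    by (simp add: abs_mult)
  moreover have "2 * \<bar>s * t\<bar> * ?A \<le> (s\<^sup>2 + t\<^sup>2) * ?A"
  proof -
    have "0 \<le> (\<bar>s\<bar> - \<bar>t\<bar>)\<^sup>2" by simp
    then have "2 * \<bar>s * t\<bar> \<le> s\<^sup>2 + t\<^sup>2" by (simp add: power2_diff abs_mult)
    then show ?thesis using pos(1) by (intro mult_right_mono) auto
  qed
  moreover have "t\<^sup>2 * ?A \<le> t\<^sup>2 * ?C" using pos by (intro mult_left_mono) auto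
  ultimately have "s\<^sup>2 * ?A + t\<^sup>2 * ?C \<le> 2 * dot (s *s a + t *s c) (s *s a + t *s c)"
    unfolding dot_lincomb_self by (simp add: algebra_simps)
  moreover have "0 \<le> s\<^sup>2 * ?A" "0 \<le> t\<^sup>2 * ?C" using pos by auto
  ultimately show "s\<^sup>2 * ?A \<le> 2 * dot (s *s a + t *s c) (s *s a + t *s c)"
    "t\<^sup>2 * ?C \<le> 2 * dot (s *s a + t *s c) (s *s a + t *s c)" by linarith+
qed

lemma skew_eq_reduced_multiple:
  assumes "reduced_basis p q a c" and "dot p q = 0"
  shows "\<exists>k. \<forall>i j. skew p q $ i $ j = k * wedge a c $ i $ j"
proof (rule skew_eq_multiple_wedge[OF assms(1)])
  show "skew q p ** skew p q = 0"
    using skew_mult_dual[of q p] assms(2) by (simp add: dot_commute mat_zero)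
qed

text \<open>The nonzero matrix \<^term>\<open>skew p q\<close> is an integer multiple of \<^term>\<open>wedge a c\<close>, which is
therefore no larger; and for a reduced basis the wedge product has about the size of the product of the
lengths.\<close>

lemma reduced_basis_size:
  assumes "reduced_basis p q a c" and "dot p q = 0" and "skew p q \<noteq> 0"
    and "p \<in> int_box T" and "q \<in> int_box T"
  shows "dot a a * dot c c \<le> 11 * (int T)\<^sup>2"
proof -
  obtain k where k: "\<And>i j. skew p q $ i $ j = k * wedge a c $ i $ j"
    using skew_eq_reduced_multiple[OF assms(1,2)] by blast
  have "k \<noteq> 0" using k assms(3) by (auto simp: vec_eq_iff)
  then have "1 \<le> k\<^sup>2" by (simp add: int_one_le_iff_zero_less)
  then have "sq_norm (wedge a c) \<le> sq_norm (skew p q)"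
    unfolding sq_norm_multiple[OF k] using mult_right_mono[of 1 "k\<^sup>2"] sq_norm_nonneg by fastforce
  then show ?thesis
    using sq_norm_skew_le[OF assms(4,5)] sq_norm_wedge_reduced(1)[OF assms(1)]
      zero_le_power2[of "int T"] by linarith
qed

text \<open>The orthogonal lattice has no larger covolume: the Hodge dual of \<^term>\<open>wedge a c\<close> is a nonzero integer multiple of
\<^term>\<open>wedge b d\<close>.\<close>

lemma dual_reduced_basis_size:
  assumes ac: "reduced_basis p q a c" and bd: "reduced_basis q p b d"
    and "dot p q = 0" and "skew p q \<noteq> 0"
  shows "3 * (dot b b * dot d d) \<le> 4 * (dot a a * dot c c)"
proof -
  obtain w z where wz: "wedge a c = skew w z" "dot w z = 0"
    using wedge_eq_skew by blast
  obtain k where k: "\<And>i j. skew p q $ i $ j = k * wedge a c $ i $ j"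
    using skew_eq_reduced_multiple[OF ac assms(3)] by blast
  have "(skew p q ** skew z w) $ i $ j = k * (skew w z ** skew z w) $ i $ j" for i j
    by (simp add: matrix_matrix_mult_def k wz sum_distrib_left mult_ac)
  then have "skew p q ** skew z w = 0"
    using skew_mult_dual[of w z] wz(2) by (simp add: vec_eq_iff mat_zero)
  then obtain m where m: "\<And>i j. skew z w $ i $ j = m * wedge b d $ i $ j"
    using skew_eq_multiple_wedge[OF bd] by blast
  have "skew z w \<noteq> 0"
  proof
    assume "skew z w = 0"
    then have "sq_norm (wedge a c) = 0"
      using sq_norm_skew_dual[of z w] wz(1) sq_norm_eq_0_iff[of "skew z w"] by metis
    then show False
      using ac sq_norm_eq_0_iff[of "wedge a c"] by (simp add: reduced_basis_def)
  qed
  then have "m \<noteq> 0" using m by (auto simp: vec_eq_iff)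
  then have "1 \<le> m\<^sup>2" by (simp add: int_one_le_iff_zero_less)
  then have "sq_norm (wedge b d) \<le> sq_norm (skew z w)"
    unfolding sq_norm_multiple[OF m] using mult_right_mono[of 1 "m\<^sup>2"] sq_norm_nonneg by fastforce
  also have "\<dots> = sq_norm (wedge a c)" using sq_norm_skew_dual[of w z] wz(1) by simp
  finally show ?thesis
    using sq_norm_wedge_reduced[OF ac] sq_norm_wedge_reduced[OF bd] by linarith
qed

lemma card_le_fibres:
  assumes "finite S" and "\<And>y. y \<in> f ` S \<Longrightarrow> real (card {x \<in> S. f x = y}) \<le> n"
  shows "real (card S) \<le> n * real (card (f ` S))"
proof -
  have "card S = (\<Sum>y\<in>f ` S. card {x \<in> S. f x = y})"
    unfolding card_eq_sum by (rule sum.image_gen[OF assms(1)])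
  then have "real (card S) = (\<Sum>y\<in>f ` S. real (card {x \<in> S. f x = y}))" by simp
  also have "\<dots> \<le> (\<Sum>y\<in>f ` S. n)" by (intro sum_mono assms(2))
  finally show ?thesis by (simp add: mult.commute)
qed

section \<open>Lines that meet a fixed line\<close>

definition meeting_lines :: "nat \<Rightarrow> int ^ 3 \<Rightarrow> int ^ 3 \<Rightarrow> ((int ^ 3) \<times> (int ^ 3)) set" where
  "meeting_lines R p q = {(x, y). x \<in> int_box R \<and> y \<in> int_box R \<and> dot x y = 0 \<and> dot x q + dot y p = 0}"

lemma finite_int_box: "finite (int_box R :: (int ^ 3) set)"
proof -
  have "(int_box R :: (int ^ 3) set) \<subseteq>
      (\<lambda>(a, b, c). vector [a, b, c]) ` ({- int R..int R} \<times> {- int R..int R} \<times> {- int R..int R})"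
  proof
    fix x :: "int ^ 3" assume "x \<in> int_box R"
    then have "x = (\<lambda>(a, b, c). vector [a, b, c]) (x $ 1, x $ 2, x $ 3)"
        "(x $ 1, x $ 2, x $ 3) \<in> {- int R..int R} \<times> {- int R..int R} \<times> {- int R..int R}"
      by (auto simp: vec_eq_iff forall_3 int_box_def abs_le_iff minus_le_iff)
    then show "x \<in> (\<lambda>(a, b, c). vector [a, b, c]) ` ({- int R..int R} \<times> {- int R..int R} \<times> {- int R..int R})"
      by blast
  qed
  then show ?thesis by (rule finite_subset) simp
qed

lemma finite_meeting_lines: "finite (meeting_lines R p q)"
  by (rule finite_subset[of _ "int_box R \<times> int_box R"]) (auto simp: meeting_lines_def finite_int_box)

lemma skew_diff: "skew (x - x') (y - y') = skew x y - skew x' y'"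
  by (simp add: vec_eq_iff forall_4 skew_nth)

text \<open>This determines the fibres of the map that sends a line meeting $(p, q)$ to the images of $b$ and $d$.\<close>

lemma skew_vanishing_on_dual:
  assumes ac: "reduced_basis p q a c" and bd: "reduced_basis q p b d" and pq: "dot p q = 0"
    and "skew x y *v b = 0" and "skew x y *v d = 0"
  shows "\<exists>k. \<forall>i j. skew x y $ i $ j = k * wedge a c $ i $ j"
proof (rule skew_eq_multiple_wedge[OF ac])
  have "skew p q ** skew q p = 0"
    using skew_mult_dual[of p q] pq by (simp add: mat_zero)
  then have col: "column j (skew q p) \<in> line_lattice q p" for j
    using columns_in_line_lattice_iff by blast
  have "skew x y *v column j (skew q p) = 0" for j
  proof -
    obtain s t where "column j (skew q p) = s *s b + t *s d"
      using bd col unfolding reduced_basis_def by blast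
    then show ?thesis using assms(4,5) by (simp add: matrix_vector_mult_lincomb)
  qed
  then have "skew x y ** skew q p = 0"
    by (auto simp: vec_eq_iff matrix_matrix_mult_def matrix_vector_mult_def column_def)
  then have "transpose (skew x y ** skew q p) = 0"
    by (simp add: transpose_def vec_eq_iff)
  then have "(- skew q p) ** (- skew x y) = 0"
    by (simp add: matrix_transpose_mul skew_transpose)
  then show "skew q p ** skew x y = 0"
    by (simp add: vec_eq_iff matrix_matrix_mult_def)
qed

text \<open>Here $v$ stands for the squared length of an image $X b$, where $X$ has entries at most $R$ and $b$ has
squared length $B$; $A$ is the squared length of the basis vector with the coefficient $k$.\<close>

lemma coefficient_bound:
  fixes k A B :: int
  assumes "k\<^sup>2 * A \<le> 2 * v" and "v \<le> 16 * (int R)\<^sup>2 * B" and "1 \<le> A" and "1 \<le> B"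
  shows "\<bar>real_of_int k\<bar> \<le> 6 * real R * sqrt (real_of_int B) / sqrt (real_of_int A)"
proof -
  have "k\<^sup>2 * A \<le> 36 * (int R)\<^sup>2 * B"
  proof -
    have "0 \<le> (int R)\<^sup>2 * B" using assms(4) by simp
    then show ?thesis using assms(1,2) by linarith
  qed
  then have "real_of_int (k\<^sup>2 * A) \<le> real_of_int (36 * (int R)\<^sup>2 * B)"
    by (rule of_int_le_iff[THEN iffD2])
  then have "sqrt ((real_of_int k)\<^sup>2 * real_of_int A) \<le> sqrt ((6 * real R)\<^sup>2 * real_of_int B)"
    by (intro real_sqrt_le_mono) (simp add: power_mult_distrib)
  then have "\<bar>real_of_int k\<bar> * sqrt (real_of_int A) \<le> 6 * real R * sqrt (real_of_int B)"
    by (simp add: real_sqrt_mult)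
  then show ?thesis using assms(3) by (simp add: pos_le_divide_eq)
qed

text \<open>Let $X$ be the skew matrix of a line that meets the line $(p, q)$.  Then $X b$ and $X d$ are integer
combinations of $a$ and $c$, and they are parallel; so $X$ yields a singular $2 \times 2$ integer
matrix.  If $\alpha \le \gamma$ and $\beta \le \delta$ are the lengths of $a, c$ and $b, d$, its entries
are at most $6R$ times the four quotients of $\beta$ or $\delta$ by $\alpha$ or $\gamma$.  The entries
on a diagonal have bounds with product at most of size $R^2$, since $\beta\delta$ is at most a multiple of
$\alpha\gamma$.  Hence the number of these matrices is at most a multiple of
$R^{2+\epsilon}(1 + \gamma/\alpha + \alpha\gamma/\beta^2)$.  Matrices $X$ with the same
image differ by a multiple of \<^term>\<open>wedge a c\<close>, which leaves a number of choices of order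
$R/(\alpha\gamma)$.\<close>

lemma card_meeting_lines:
  fixes \<epsilon> :: real
  assumes "\<epsilon> > 0"
  shows "\<exists>K\<ge>1. \<forall>R T p q a c b d. 1 \<le> T \<longrightarrow> T \<le> R \<longrightarrow> p \<in> int_box T \<longrightarrow> q \<in> int_box T \<longrightarrow>
      dot p q = 0 \<longrightarrow> skew p q \<noteq> 0 \<longrightarrow> reduced_basis p q a c \<longrightarrow> reduced_basis q p b d \<longrightarrow>
      real (card (meeting_lines R p q))
        \<le> K * real R powr (3 + \<epsilon>) * (1 / real_of_int (dot a a) + 1 / real_of_int (dot b b))"
proof -
  have e2: "\<epsilon> / 2 > 0" using assms by simp
  obtain K where K: "K \<ge> 1" "\<forall>A B C D :: real. A \<ge> 1 \<longrightarrow> B \<ge> 1 \<longrightarrow> C \<ge> 1 \<longrightarrow> D \<ge> 1 \<longrightarrow>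
     (finite (singular_matrices A B C D) \<and> real (card (singular_matrices A B C D)) \<le> K * ((A * D) powr (1 + \<epsilon> / 2) + (A + D) * (B + C)))"
    using card_singular_matrices[OF e2] by (elim exE conjE) (rule that)
  define K' where "K' = 18 * K * (72 powr (1 + \<epsilon> / 2) + 216)"
  have main: "real (card (meeting_lines R p q))
        \<le> K' * real R powr (3 + \<epsilon>) * (1 / real_of_int (dot a a) + 1 / real_of_int (dot b b))"
    if T: "1 \<le> T" "T \<le> R" and box: "p \<in> int_box T" "q \<in> int_box T" and pq: "dot p q = 0"
      and nz: "skew p q \<noteq> 0" and ac: "reduced_basis p q a c" and bd: "reduced_basis q p b d"
    for R T p q a c b d
  proof -
    define S where "S = meeting_lines R p q"
    define r where "r = real R"
    define \<alpha> \<gamma> \<beta> \<delta> where "\<alpha> = sqrt (real_of_int (dot a a))" and "\<gamma> = sqrt (real_of_int (dot c c))"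
      and "\<beta> = sqrt (real_of_int (dot b b))" and "\<delta> = sqrt (real_of_int (dot d d))"
    note pa = reduced_basis_pos[OF ac] and pb = reduced_basis_pos[OF bd]
    have r1: "r \<ge> 1" using T by (simp add: r_def)
    have ord: "1 \<le> \<alpha>" "\<alpha> \<le> \<gamma>" "1 \<le> \<beta>" "\<beta> \<le> \<delta>"
      using pa pb by (simp_all add: \<alpha>_def \<gamma>_def \<beta>_def \<delta>_def)
    have pos: "0 < \<alpha>" "0 < \<gamma>" "0 < \<beta>" "0 < \<delta>" using ord by linarith+
    have size: "\<alpha> * \<gamma> \<le> 4 * r"
    proof -
      have "dot a a * dot c c \<le> 11 * (int T)\<^sup>2"
        by (rule reduced_basis_size[OF ac pq nz box])
      also have "\<dots> \<le> 16 * (int R)\<^sup>2" using T by (intro mult_mono power_mono) auto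
      finally have "real_of_int (dot a a * dot c c) \<le> real_of_int (16 * (int R)\<^sup>2)"
        by (rule of_int_le_iff[THEN iffD2])
      then have "sqrt (real_of_int (dot a a * dot c c)) \<le> sqrt ((4 * real R)\<^sup>2)"
        by (intro real_sqrt_le_mono) (simp add: power_mult_distrib)
      then show ?thesis by (simp add: \<alpha>_def \<gamma>_def r_def real_sqrt_mult)
    qed
    have dual: "\<beta> * \<delta> \<le> 2 * (\<alpha> * \<gamma>)"
    proof -
      have "3 * (dot b b * dot d d) \<le> 4 * (dot a a * dot c c)"
        by (rule dual_reduced_basis_size[OF ac bd pq nz])
      moreover have "0 \<le> dot b b * dot d d" using pb by simp
      ultimately have "dot b b * dot d d \<le> 2\<^sup>2 * (dot a a * dot c c)" by simp
      then have "real_of_int (dot b b * dot d d) \<le> real_of_int (2\<^sup>2 * (dot a a * dot c c))"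
        by (rule of_int_le_iff[THEN iffD2])
      then have "sqrt (real_of_int (dot b b * dot d d)) \<le> sqrt (2\<^sup>2 * real_of_int (dot a a * dot c c))"
        by (intro real_sqrt_le_mono) simp
      then show ?thesis by (simp add: \<alpha>_def \<gamma>_def \<beta>_def \<delta>_def real_sqrt_mult)
    qed
    \<comment> \<open>the coordinates $f_{11}, f_{21}$ of $X b$ and $f_{12}, f_{22}$ of $X d$ with respect to $a, c$\<close>
    have in_dual: "b \<in> line_lattice q p" "d \<in> line_lattice q p" using bd by (simp_all add: reduced_basis_def)
    have "\<exists>s t. skew (fst z) (snd z) *v e = s *s a + t *s c"
      if "z \<in> S" "e \<in> line_lattice q p" for z e
    proof -
      have "skew (fst z) (snd z) *v e \<in> line_lattice p q"
        using that by (intro skew_maps_line_lattice) (auto simp: S_def meeting_lines_def)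
      then show ?thesis using ac by (simp add: reduced_basis_def)
    qed
    then have "\<forall>z\<in>S. \<exists>s t s' t'. skew (fst z) (snd z) *v b = s *s a + t *s c \<and>
        skew (fst z) (snd z) *v d = s' *s a + t' *s c"
      using in_dual by meson
    then obtain f11 f21 f12 f22 where f: "\<And>z. z \<in> S \<Longrightarrow> skew (fst z) (snd z) *v b = f11 z *s a + f21 z *s c"
        "\<And>z. z \<in> S \<Longrightarrow> skew (fst z) (snd z) *v d = f12 z *s a + f22 z *s c"
      by metis
    define F where "F = (\<lambda>z. ((f11 z, f22 z), (f12 z, f21 z)))"
    define K11 K12 K21 K22 where "K11 = 6 * r * \<beta> / \<alpha>" and "K12 = 6 * r * \<delta> / \<alpha>"
      and "K21 = 6 * r * \<beta> / \<gamma>" and "K22 = 6 * r * \<delta> / \<gamma>"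
    have K21: "1 \<le> K21"
    proof -
      have "\<gamma> \<le> \<alpha> * \<gamma>" using ord pos by simp
      then have "\<gamma> \<le> 6 * r * 1" using size r1 by linarith
      also have "\<dots> \<le> 6 * r * \<beta>" using ord r1 by (intro mult_left_mono) auto
      finally show ?thesis using pos by (simp add: K21_def)
    qed
    have K22: "K21 \<le> K22"
      unfolding K21_def K22_def using ord pos r1 by (intro divide_right_mono mult_left_mono) auto
    have K11: "K21 \<le> K11"
      unfolding K21_def K11_def using ord pos r1 by (intro divide_left_mono) auto
    have K12: "K11 \<le> K12"
      unfolding K11_def K12_def using ord pos r1 by (intro divide_right_mono mult_left_mono) auto
    have img: "F ` S \<subseteq> singular_matrices K11 K12 K21 K22"
    proof (rule image_subsetI)
      fix z assume z: "z \<in> S"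
      define x y where "x = fst z" and "y = snd z"
      have xy: "x \<in> int_box R" "y \<in> int_box R" "dot x y = 0" "dot x q + dot y p = 0"
        using z by (auto simp: S_def meeting_lines_def x_def y_def)
      let ?X = "skew x y"
      note fb = f(1)[OF z, folded x_def y_def] and fd = f(2)[OF z, folded x_def y_def]
      have im: "dot (?X *v e) (?X *v e) \<le> 16 * (int R)\<^sup>2 * dot e e" for e
        using dot_matrix_image_le[of ?X e] mult_right_mono[OF sq_norm_skew_le[OF xy(1,2)] dot_self_nonneg[of e]]
        by linarith
      have bounds: "\<bar>real_of_int (f11 z)\<bar> \<le> K11" "\<bar>real_of_int (f12 z)\<bar> \<le> K12"
          "\<bar>real_of_int (f21 z)\<bar> \<le> K21" "\<bar>real_of_int (f22 z)\<bar> \<le> K22"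
        unfolding K11_def K12_def K21_def K22_def r_def \<alpha>_def \<gamma>_def \<beta>_def \<delta>_def
        using coefficient_bound[OF reduced_coefficients_le(1)[OF ac] im[of b, unfolded fb] pa(1) pb(1)]
          coefficient_bound[OF reduced_coefficients_le(1)[OF ac] im[of d, unfolded fd] pa(1) order_trans[OF pb]]
          coefficient_bound[OF reduced_coefficients_le(2)[OF ac] im[of b, unfolded fb] order_trans[OF pa] pb(1)]
          coefficient_bound[OF reduced_coefficients_le(2)[OF ac] im[of d, unfolded fd] order_trans[OF pa] order_trans[OF pb]]
        by blast+
      have "dot b (?X *v d) = 0"
        by (rule line_lattice_orthogonal[OF skew_maps_line_lattice[OF in_dual(2) xy(4)] in_dual(1) nz])
      then have "wedge (?X *v b) (?X *v d) $ i $ j = 0" for i j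
        using wedge_skew_image[OF xy(3), of b d] by simp
      moreover have "wedge (?X *v b) (?X *v d) $ i $ j = (f11 z * f22 z - f12 z * f21 z) * wedge a c $ i $ j" for i j
        unfolding fb fd by (simp add: wedge_def algebra_simps)
      moreover obtain i j where "wedge a c $ i $ j \<noteq> 0"
        using ac by (auto simp: reduced_basis_def vec_eq_iff)
      ultimately have "f11 z * f22 z = f12 z * f21 z" by (metis eq_iff_diff_eq_0 mult_eq_0_iff)
      then show "F z \<in> singular_matrices K11 K12 K21 K22"
        using bounds by (simp add: F_def singular_matrices_def)
    qed
    \<comment> \<open>two lines with the same coordinates differ by $k$ times the wedge of $a$ and $c$, where $|k| \<le> L$\<close>
    have fibre: "real (card {z \<in> S. F z = F z0}) \<le> 18 * r / (\<alpha> * \<gamma>)" if z0: "z0 \<in> S" for z0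
    proof -
      define L where "L = 7 * r / (\<alpha> * \<gamma>)"
      have "\<exists>k. (\<forall>i j. skew (fst z - fst z0) (snd z - snd z0) $ i $ j = k * wedge a c $ i $ j)
               \<and> \<bar>real_of_int k\<bar> \<le> L"
        if z: "z \<in> S" "F z = F z0" for z
      proof -
        let ?Y = "skew (fst z - fst z0) (snd z - snd z0)"
        have "?Y *v b = 0" "?Y *v d = 0"
          using f[OF z(1)] f[OF z0] z(2) by (simp_all add: F_def skew_diff matrix_vector_mult_diff_rdistrib)
        then obtain k where k: "\<And>i j. ?Y $ i $ j = k * wedge a c $ i $ j"
          using skew_vanishing_on_dual[OF ac bd pq] by blast
        have "fst z - fst z0 \<in> int_box (2 * R)" "snd z - snd z0 \<in> int_box (2 * R)"
        proof -
          have "\<bar>u $ i - v $ i\<bar> \<le> int (2 * R)" if "u \<in> int_box R" "v \<in> int_box R" for u v :: "int ^ 3" and i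
          proof -
            have "\<bar>u $ i\<bar> \<le> int R" "\<bar>v $ i\<bar> \<le> int R" using that by (simp_all add: int_box_def)
            then show ?thesis using abs_triangle_ineq4[of "u $ i" "v $ i"] by linarith
          qed
          then show "fst z - fst z0 \<in> int_box (2 * R)" "snd z - snd z0 \<in> int_box (2 * R)"
            using z(1) z0 by (auto simp: S_def meeting_lines_def int_box_def[of "2 * R"])
        qed
        then have "k\<^sup>2 * sq_norm (wedge a c) \<le> 16 * (int (2 * R))\<^sup>2"
          using sq_norm_skew_le sq_norm_multiple[OF k] by metis
        moreover have "k\<^sup>2 * (3 * (dot a a * dot c c)) \<le> k\<^sup>2 * (2 * sq_norm (wedge a c))"
          using sq_norm_wedge_reduced(1)[OF ac] by (intro mult_left_mono) auto
        ultimately have "3 * (k\<^sup>2 * (dot a a * dot c c)) \<le> 128 * (int R)\<^sup>2"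
          by (simp add: algebra_simps power_mult_distrib)
        then have "k\<^sup>2 * (dot a a * dot c c) \<le> 49 * (int R)\<^sup>2"
          using zero_le_power2[of "int R"] by linarith
        then have "real_of_int (k\<^sup>2 * (dot a a * dot c c)) \<le> real_of_int (49 * (int R)\<^sup>2)"
          by (rule of_int_le_iff[THEN iffD2])
        then have "sqrt ((real_of_int k)\<^sup>2 * (real_of_int (dot a a) * real_of_int (dot c c))) \<le> sqrt ((7 * real R)\<^sup>2)"
          by (intro real_sqrt_le_mono) (simp add: power_mult_distrib)
        then have "\<bar>real_of_int k\<bar> * (\<alpha> * \<gamma>) \<le> 7 * r"
          by (simp add: real_sqrt_mult \<alpha>_def \<gamma>_def r_def)
        then have "\<bar>real_of_int k\<bar> \<le> L"
          using pos by (simp add: L_def pos_le_divide_eq)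
        then show ?thesis using k by blast
      qed
      then obtain g where g: "\<And>z i j. z \<in> S \<Longrightarrow> F z = F z0 \<Longrightarrow>
            skew (fst z - fst z0) (snd z - snd z0) $ i $ j = g z * wedge a c $ i $ j"
          "\<And>z. z \<in> S \<Longrightarrow> F z = F z0 \<Longrightarrow> \<bar>real_of_int (g z)\<bar> \<le> L"
        by metis
      have "inj_on g {z \<in> S. F z = F z0}"
      proof (rule inj_onI)
        fix z z' assume z: "z \<in> {z \<in> S. F z = F z0}" "z' \<in> {z \<in> S. F z = F z0}" "g z = g z'"
        then have "skew (fst z - fst z0) (snd z - snd z0) = skew (fst z' - fst z0) (snd z' - snd z0)"
          unfolding vec_eq_iff using g(1) by auto
        then show "z = z'" unfolding skew_eq_iff by (simp add: prod_eq_iff)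
      qed
      then have "card {z \<in> S. F z = F z0} \<le> card {k::int. \<bar>real_of_int k\<bar> \<le> L}"
        using g(2) by (intro card_inj_on_le[of g]) auto
      also have "real \<dots> \<le> 2 * L + 1"
        using pos r1 by (intro card_abs_le_real) (simp add: L_def)
      also have "\<dots> \<le> 18 * r / (\<alpha> * \<gamma>)"
      proof -
        \<comment> \<open>$18 = 2 \cdot 7 + 4$, where the $4$ pays for the summand $1$ in $2L + 1$\<close>
        have "1 \<le> 4 * r / (\<alpha> * \<gamma>)" using size pos by simp
        then show ?thesis by (simp add: L_def add_divide_distrib)
      qed
      finally show ?thesis by simp
    qed
    have "real (card S) \<le> 18 * r / (\<alpha> * \<gamma>) * real (card (F ` S))"
      using finite_meeting_lines fibre by (intro card_le_fibres) (auto simp: S_def)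
    also have "\<dots> \<le> 18 * r / (\<alpha> * \<gamma>) * (K * ((K11 * K22) powr (1 + \<epsilon> / 2) + (K11 + K22) * (K12 + K21)))"
    proof (rule mult_left_mono)
      have fs: "finite (singular_matrices K11 K12 K21 K22)"
        "real (card (singular_matrices K11 K12 K21 K22)) \<le> K * ((K11 * K22) powr (1 + \<epsilon> / 2) + (K11 + K22) * (K12 + K21))"
        using K(2) K21 K22 K11 K12 by auto
      then show "real (card (F ` S)) \<le> K * ((K11 * K22) powr (1 + \<epsilon> / 2) + (K11 + K22) * (K12 + K21))"
        using card_mono[OF fs(1) img] by linarith
    qed (use pos r1 in simp)
    also have "\<dots> \<le> 18 * r / (\<alpha> * \<gamma>) * (K * (72 powr (1 + \<epsilon> / 2) * r powr (2 + \<epsilon>)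
                     + 36 * r powr (2 + \<epsilon>) * (2 * \<gamma> / \<alpha> + 4 + 4 * (\<alpha> * \<gamma>) / \<beta>\<^sup>2)))"
    proof (intro mult_left_mono add_mono)
      have bd2: "\<beta> * \<delta> / (\<alpha> * \<gamma>) \<le> 2"
        using dual pos by (simp add: pos_divide_le_eq)
      have "K11 * K22 = 36 * r\<^sup>2 * (\<beta> * \<delta> / (\<alpha> * \<gamma>))"
        by (simp add: K11_def K22_def power2_eq_square)
      also have "\<dots> \<le> 36 * r\<^sup>2 * 2" using bd2 by (intro mult_left_mono) auto
      finally have "K11 * K22 \<le> 72 * r\<^sup>2" by simp
      then have "(K11 * K22) powr (1 + \<epsilon> / 2) \<le> (72 * r\<^sup>2) powr (1 + \<epsilon> / 2)"
        using assms K11 K21 K22 by (intro powr_mono2) auto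
      also have "\<dots> = 72 powr (1 + \<epsilon> / 2) * (r powr 2) powr (1 + \<epsilon> / 2)"
        using r1 by (simp add: powr_mult)
      also have "(r powr 2) powr (1 + \<epsilon> / 2) = r powr (2 + \<epsilon>)"
        by (simp add: powr_powr algebra_simps)
      finally show "(K11 * K22) powr (1 + \<epsilon> / 2) \<le> 72 powr (1 + \<epsilon> / 2) * r powr (2 + \<epsilon>)" .
      have "(K11 + K22) * (K12 + K21)
          = 36 * r\<^sup>2 * (\<beta> * \<delta> / \<alpha>\<^sup>2 + \<beta>\<^sup>2 / (\<alpha> * \<gamma>) + \<delta>\<^sup>2 / (\<alpha> * \<gamma>) + \<beta> * \<delta> / \<gamma>\<^sup>2)"
        using pos by (simp add: K11_def K22_def K12_def K21_def power2_eq_square field_simps)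
      also have "\<dots> \<le> 36 * r\<^sup>2 * (2 * \<gamma> / \<alpha> + 2 + 4 * (\<alpha> * \<gamma>) / \<beta>\<^sup>2 + 2)"
      proof (intro mult_left_mono add_mono)
        have "\<beta> * \<delta> / \<alpha>\<^sup>2 \<le> 2 * (\<alpha> * \<gamma>) / \<alpha>\<^sup>2" using dual by (intro divide_right_mono) auto
        also have "\<dots> = 2 * \<gamma> / \<alpha>" using pos by (simp add: power2_eq_square)
        finally show "\<beta> * \<delta> / \<alpha>\<^sup>2 \<le> 2 * \<gamma> / \<alpha>" .
        have "\<beta>\<^sup>2 / (\<alpha> * \<gamma>) \<le> \<beta> * \<delta> / (\<alpha> * \<gamma>)"
          unfolding power2_eq_square using ord pos by (intro divide_right_mono mult_left_mono) auto
        then show "\<beta>\<^sup>2 / (\<alpha> * \<gamma>) \<le> 2" using bd2 by linarith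
        have "(\<beta> * \<delta>)\<^sup>2 \<le> (2 * (\<alpha> * \<gamma>))\<^sup>2" using dual pos by (intro power_mono) auto
        then have "(\<beta> * \<delta>)\<^sup>2 / ((\<alpha> * \<gamma>) * \<beta>\<^sup>2) \<le> (2 * (\<alpha> * \<gamma>))\<^sup>2 / ((\<alpha> * \<gamma>) * \<beta>\<^sup>2)"
          using pos by (intro divide_right_mono) auto
        then show "\<delta>\<^sup>2 / (\<alpha> * \<gamma>) \<le> 4 * (\<alpha> * \<gamma>) / \<beta>\<^sup>2"
          using pos by (simp add: power_mult_distrib power2_eq_square)
        have "\<beta> * \<delta> / \<gamma>\<^sup>2 \<le> \<beta> * \<delta> / (\<alpha> * \<gamma>)"
          unfolding power2_eq_square using ord pos by (intro divide_left_mono mult_right_mono) auto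
        then show "\<beta> * \<delta> / \<gamma>\<^sup>2 \<le> 2" using bd2 by linarith
      qed simp
      also have "\<dots> = 36 * r\<^sup>2 * (2 * \<gamma> / \<alpha> + 4 + 4 * (\<alpha> * \<gamma>) / \<beta>\<^sup>2)" by simp
      also have "\<dots> \<le> 36 * r powr (2 + \<epsilon>) * (2 * \<gamma> / \<alpha> + 4 + 4 * (\<alpha> * \<gamma>) / \<beta>\<^sup>2)"
      proof (intro mult_right_mono mult_left_mono)
        have "r powr 2 \<le> r powr (2 + \<epsilon>)" using assms r1 by (intro powr_mono) auto
        then show "r\<^sup>2 \<le> r powr (2 + \<epsilon>)" using r1 by simp
      qed (use pos in auto)
      finally show "(K11 + K22) * (K12 + K21) \<le> 36 * r powr (2 + \<epsilon>) * (2 * \<gamma> / \<alpha> + 4 + 4 * (\<alpha> * \<gamma>) / \<beta>\<^sup>2)" .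
    qed (use K(1) pos r1 in auto)
    also have "\<dots> = 18 * K * (r * r powr (2 + \<epsilon>)) *
        (72 powr (1 + \<epsilon> / 2) * (1 / (\<alpha> * \<gamma>)) + 72 * (1 / \<alpha>\<^sup>2) + 144 * (1 / (\<alpha> * \<gamma>)) + 144 * (1 / \<beta>\<^sup>2))"
      using pos by (simp add: field_simps power2_eq_square)
    also have "r * r powr (2 + \<epsilon>) = r powr (3 + \<epsilon>)"
    proof -
      have "r powr (3 + \<epsilon>) = r powr (1 + (2 + \<epsilon>))" by (simp add: add.assoc)
      then show ?thesis using r1 unfolding powr_add[of r 1] by simp
    qed
    also have "18 * K * r powr (3 + \<epsilon>) *
        (72 powr (1 + \<epsilon> / 2) * (1 / (\<alpha> * \<gamma>)) + 72 * (1 / \<alpha>\<^sup>2) + 144 * (1 / (\<alpha> * \<gamma>)) + 144 * (1 / \<beta>\<^sup>2))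
       \<le> 18 * K * r powr (3 + \<epsilon>) * ((72 powr (1 + \<epsilon> / 2) + 216) * (1 / \<alpha>\<^sup>2 + 1 / \<beta>\<^sup>2))"
    proof (rule mult_left_mono)
      have 1: "1 / (\<alpha> * \<gamma>) \<le> 1 / \<alpha>\<^sup>2"
        unfolding power2_eq_square using ord pos by (intro divide_left_mono mult_left_mono) auto
      then have "72 powr (1 + \<epsilon> / 2) * (1 / (\<alpha> * \<gamma>)) \<le> 72 powr (1 + \<epsilon> / 2) * (1 / \<alpha>\<^sup>2)"
        by (intro mult_left_mono) auto
      moreover have "0 \<le> 72 powr (1 + \<epsilon> / 2) * (1 / \<beta>\<^sup>2)" "0 \<le> 1 / \<beta>\<^sup>2" by auto
      ultimately show "72 powr (1 + \<epsilon> / 2) * (1 / (\<alpha> * \<gamma>)) + 72 * (1 / \<alpha>\<^sup>2) + 144 * (1 / (\<alpha> * \<gamma>)) + 144 * (1 / \<beta>\<^sup>2)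
          \<le> (72 powr (1 + \<epsilon> / 2) + 216) * (1 / \<alpha>\<^sup>2 + 1 / \<beta>\<^sup>2)"
        using 1 unfolding distrib_left distrib_right by linarith
    qed (use K(1) r1 in auto)
    finally show ?thesis
      using pa pb by (simp add: S_def K'_def r_def \<alpha>_def \<beta>_def algebra_simps)
  qed
  have "1 \<le> K'"
  proof -
    have "1 * 1 \<le> (18 * K) * (72 powr (1 + \<epsilon> / 2) + 216)"
      using K(1) by (intro mult_mono) (auto intro: order_trans[of 1 216])
    then show ?thesis by (simp add: K'_def)
  qed
  then show ?thesis
    by (intro exI[of _ K'] conjI allI impI) (assumption, rule main)
qed

section \<open>Pairs of meeting lines\<close>

lemma
  fixes X :: "'n::finite \<Rightarrow> int set"
  assumes "\<And>j. finite (X j)"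
  shows finite_vec_box: "finite {v :: int ^ 'n. \<forall>j. v $ j \<in> X j}"
    and card_vec_box: "card {v :: int ^ 'n. \<forall>j. v $ j \<in> X j} = (\<Prod>j\<in>UNIV. card (X j))"
proof -
  have bij: "bij_betw vec_nth {v :: int ^ 'n. \<forall>j. v $ j \<in> X j} (PiE UNIV X)"
    by (rule bij_betwI[of _ _ _ vec_lambda]) (auto simp: vec_eq_iff)
  then show "card {v :: int ^ 'n. \<forall>j. v $ j \<in> X j} = (\<Prod>j\<in>UNIV. card (X j))"
    by (simp add: bij_betw_same_card card_PiE)
  show "finite {v :: int ^ 'n. \<forall>j. v $ j \<in> X j}"
    using bij_betw_finite[OF bij] assms by (simp add: finite_PiE)
qed

lemma card_vec_slab:
  fixes i :: 4
  assumes "finite U" and "finite V"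
  shows "finite {v :: int ^ 4. v $ i \<in> U \<and> (\<forall>j. j \<noteq> i \<longrightarrow> v $ j \<in> V)}"
    and "card {v :: int ^ 4. v $ i \<in> U \<and> (\<forall>j. j \<noteq> i \<longrightarrow> v $ j \<in> V)} = card U * card V ^ 3"
proof -
  let ?X = "\<lambda>j. if j = i then U else V"
  have eq: "{v :: int ^ 4. v $ i \<in> U \<and> (\<forall>j. j \<noteq> i \<longrightarrow> v $ j \<in> V)} = {v. \<forall>j. v $ j \<in> ?X j}"
    by auto
  have fin: "finite (?X j)" for j using assms by simp
  show "finite {v :: int ^ 4. v $ i \<in> U \<and> (\<forall>j. j \<noteq> i \<longrightarrow> v $ j \<in> V)}"
    unfolding eq by (rule finite_vec_box[OF fin])
  show "card {v :: int ^ 4. v $ i \<in> U \<and> (\<forall>j. j \<noteq> i \<longrightarrow> v $ j \<in> V)} = card U * card V ^ 3"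
    unfolding eq card_vec_box[OF fin] UNIV_4
    using exhaust_4[of i] by (auto simp: power3_eq_cube)
qed

lemma sum_inverse_le_powr:
  fixes \<epsilon> :: real and n :: nat
  assumes "\<epsilon> > 0" and "n \<ge> 1"
  shows "(\<Sum>k=1..n. 1 / real k) \<le> (1 + 1 / \<epsilon>) * real n powr \<epsilon>"
proof -
  have "(\<Sum>k=1..n. 1 / real k) \<le> 1 + ln (real n)"
    using assms(2)
  proof (induction n rule: dec_induct)
    case (step n)
    have "ln (real n / real (Suc n)) \<le> real n / real (Suc n) - 1"
      using step.hyps by (intro ln_le_minus_one) auto
    also have "\<dots> = - (1 / real (Suc n))" by (simp add: field_simps)
    finally have "1 / real (Suc n) \<le> ln (real (Suc n)) - ln (real n)"
      using step.hyps by (simp add: ln_div)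
    then show ?case using step.IH step.hyps by simp
  qed simp
  also have "ln (real n) \<le> real n powr \<epsilon> / \<epsilon>"
  proof -
    have "\<epsilon> * ln (real n) = ln (real n powr \<epsilon>)" using assms by (simp add: ln_powr)
    also have "\<dots> \<le> real n powr \<epsilon>" using assms(2) by (intro order_trans[OF ln_le_minus_one]) auto
    finally show ?thesis using assms(1) by (simp add: pos_le_divide_eq mult.commute)
  qed
  also have "1 + real n powr \<epsilon> / \<epsilon> \<le> (1 + 1 / \<epsilon>) * real n powr \<epsilon>"
    using assms by (simp add: distrib_right ge_one_powr_ge_zero)
  finally show ?thesis by simp
qed

definition int_lines :: "nat \<Rightarrow> ((int ^ 3) \<times> (int ^ 3)) set" where
  "int_lines T = {(p, q). p \<in> int_box T \<and> q \<in> int_box T \<and> dot p q = 0 \<and> skew p q \<noteq> 0}"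

text \<open>The first vector of a reduced basis is a shortest nonzero vector of the lattice.\<close>

definition shortest :: "int ^ 3 \<Rightarrow> int ^ 3 \<Rightarrow> int ^ 4" where
  "shortest p q = (SOME a. \<exists>c. reduced_basis p q a c)"

lemma shortest:
  assumes "(p, q) \<in> int_lines T"
  shows "\<exists>c. reduced_basis p q (shortest p q) c"
  unfolding shortest_def
  by (rule someI_ex) (use assms reduced_basis_exists in \<open>auto simp: int_lines_def\<close>)

lemma finite_int_lines: "finite (int_lines T)"
  by (rule finite_subset[of _ "int_box T \<times> int_box T"]) (auto simp: int_lines_def finite_int_box)

lemma abs_le_if_sq_mult_le:
  fixes v A :: int
  assumes "v\<^sup>2 * A \<le> 11 * (int T)\<^sup>2" and "1 \<le> A"
  shows "\<bar>real_of_int v\<bar> \<le> 4 * real T / sqrt (real_of_int A)"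
proof -
  have "v\<^sup>2 * A \<le> 16 * (int T)\<^sup>2" using assms(1) zero_le_power2[of "int T"] by linarith
  then have "real_of_int (v\<^sup>2 * A) \<le> real_of_int (16 * (int T)\<^sup>2)"
    by (rule of_int_le_iff[THEN iffD2])
  then have "sqrt ((real_of_int v)\<^sup>2 * real_of_int A) \<le> sqrt ((4 * real T)\<^sup>2)"
    by (intro real_sqrt_le_mono) (simp add: power_mult_distrib)
  then have "\<bar>real_of_int v\<bar> * sqrt (real_of_int A) \<le> 4 * real T"
    by (simp add: real_sqrt_mult)
  then show ?thesis using assms(2) by (simp add: pos_le_divide_eq)
qed

lemma coordinate_sq_le_dot: "(v $ j)\<^sup>2 \<le> dot v v"
  unfolding dot_def power2_eq_square by (rule member_le_sum) auto

text \<open>The line is an integer multiple of \<^term>\<open>wedge a c\<close> for a reduced basis, hence the wedge of $a$ with a multiple of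
$c$, and the latter may be changed by multiples of $a$.  Reducing it modulo $a$ in a coordinate $i$ where
$a$ is largest confines it to a slab: for given $a$ it can take about $|a| (T/|a|)^3$ values, while
its size alone would leave $(T/|a|)^4$.\<close>

lemma line_as_wedge:
  assumes "(p, q) \<in> int_lines T"
  shows "\<exists>i c. let a = shortest p q in
    skew p q = wedge a c \<and> a $ i \<noteq> 0 \<and> (\<forall>j. \<bar>a $ j\<bar> \<le> \<bar>a $ i\<bar>) \<and> dot a a \<le> 4 * int T \<and>
    0 \<le> c $ i \<and> c $ i < \<bar>a $ i\<bar> \<and>
    (\<forall>j. \<bar>real_of_int (c $ j)\<bar> \<le> 12 * real T / sqrt (real_of_int (dot a a)))"
proof -
  have pq: "dot p q = 0" "skew p q \<noteq> 0" and box: "p \<in> int_box T" "q \<in> int_box T"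
    using assms by (auto simp: int_lines_def)
  define a where "a = shortest p q"
  obtain c where ac: "reduced_basis p q a c"
    using shortest[OF assms] by (auto simp: a_def)
  note pos = reduced_basis_pos[OF ac]
  obtain k where k: "\<And>i j. skew p q $ i $ j = k * wedge a c $ i $ j"
    using skew_eq_reduced_multiple[OF ac pq(1)] by blast
  have "Max (range (\<lambda>j. \<bar>a $ j\<bar>)) \<in> range (\<lambda>j. \<bar>a $ j\<bar>)"
    by (rule Max_in) auto
  then obtain i where "Max (range (\<lambda>j. \<bar>a $ j\<bar>)) = \<bar>a $ i\<bar>" by (rule rangeE)
  then have i: "\<bar>a $ j\<bar> \<le> \<bar>a $ i\<bar>" for j
    by (metis Max_ge finite finite_imageI rangeI)
  have ai: "a $ i \<noteq> 0"
  proof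
    assume "a $ i = 0"
    then have "a = 0" using i by (auto simp: vec_eq_iff)
    then show False using pos(1) by (simp add: dot_def)
  qed
  define v where "v = k *s c"
  define m where "m = sgn (a $ i) * (v $ i div \<bar>a $ i\<bar>)"
  \<comment> \<open>the shift by $m a$ reduces the coordinate $i$ modulo $|a_i|$\<close>
  define d where "d = v - m *s a"
  have "skew p q = wedge a d"
    by (simp add: vec_eq_iff k d_def v_def wedge_def algebra_simps)
  have mi: "m * a $ i = (v $ i div \<bar>a $ i\<bar>) * \<bar>a $ i\<bar>"
    by (simp add: m_def abs_sgn mult_ac)
  have di: "d $ i = v $ i mod \<bar>a $ i\<bar>"
    by (simp add: d_def mi minus_div_mult_eq_mod)
  have AC: "dot a a * dot c c \<le> 11 * (int T)\<^sup>2"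
    by (rule reduced_basis_size[OF ac pq box])
  have A2: "dot a a * dot a a \<le> 11 * (int T)\<^sup>2"
    using AC mult_left_mono[OF pos(2), of "dot a a"] pos(1) by linarith
  have A4: "dot a a \<le> 4 * int T"
  proof (rule power2_le_imp_le)
    show "(dot a a)\<^sup>2 \<le> (4 * int T)\<^sup>2"
    proof -
      have "dot a a * dot a a \<le> 16 * (int T)\<^sup>2" using A2 zero_le_power2[of "int T"] by linarith
      then show ?thesis by (simp add: power_mult_distrib power2_eq_square)
    qed
  qed simp
  have kv: "(v $ j)\<^sup>2 * dot a a \<le> 11 * (int T)\<^sup>2" for j
  proof -
    have "k\<^sup>2 * (3 * (dot a a * dot c c)) \<le> k\<^sup>2 * (2 * sq_norm (wedge a c))"
      using sq_norm_wedge_reduced(1)[OF ac] by (intro mult_left_mono) auto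
    also have "\<dots> = 2 * sq_norm (skew p q)" by (simp add: sq_norm_multiple[OF k])
    also have "\<dots> \<le> 32 * (int T)\<^sup>2" using sq_norm_skew_le[OF box] by simp
    finally have "3 * (k\<^sup>2 * (dot a a * dot c c)) \<le> 32 * (int T)\<^sup>2"
      by (simp only: mult.left_commute)
    then have "k\<^sup>2 * (dot a a * dot c c) \<le> 11 * (int T)\<^sup>2"
      using zero_le_power2[of "int T"] by linarith
    moreover have "(v $ j)\<^sup>2 * dot a a \<le> k\<^sup>2 * (dot a a * dot c c)"
    proof -
      have "(v $ j)\<^sup>2 * dot a a = k\<^sup>2 * (dot a a * (c $ j)\<^sup>2)"
        by (simp add: v_def power_mult_distrib)
      also have "\<dots> \<le> k\<^sup>2 * (dot a a * dot c c)"
        using coordinate_sq_le_dot pos(1) by (intro mult_left_mono) auto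
      finally show ?thesis .
    qed
    ultimately show ?thesis by linarith
  qed
  have ka: "(a $ i)\<^sup>2 * dot a a \<le> 11 * (int T)\<^sup>2"
    using A2 mult_right_mono[OF coordinate_sq_le_dot[of a i], of "dot a a"] pos(1) by linarith
  let ?L = "4 * real T / sqrt (real_of_int (dot a a))"
  have "\<bar>real_of_int (d $ j)\<bar> \<le> 3 * ?L" for j
  proof -
    have "\<bar>m\<bar> * \<bar>a $ j\<bar> \<le> \<bar>m\<bar> * \<bar>a $ i\<bar>" using i by (intro mult_left_mono) auto
    also have "\<dots> = \<bar>v $ i - d $ i\<bar>" by (simp add: d_def abs_mult)
    also have "\<dots> \<le> \<bar>v $ i\<bar> + \<bar>a $ i\<bar>"
      using di ai pos_mod_bound[of "\<bar>a $ i\<bar>" "v $ i"] pos_mod_sign[of "\<bar>a $ i\<bar>" "v $ i"] by linarith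
    finally have "\<bar>d $ j\<bar> \<le> \<bar>v $ j\<bar> + \<bar>v $ i\<bar> + \<bar>a $ i\<bar>"
      using abs_triangle_ineq4[of "v $ j" "m * a $ j"] by (simp add: d_def abs_mult)
    then have "\<bar>real_of_int (d $ j)\<bar> \<le> \<bar>real_of_int (v $ j)\<bar> + \<bar>real_of_int (v $ i)\<bar> + \<bar>real_of_int (a $ i)\<bar>"
      by linarith
    then show ?thesis
      using abs_le_if_sq_mult_le[OF kv[of j] pos(1)] abs_le_if_sq_mult_le[OF kv[of i] pos(1)]
        abs_le_if_sq_mult_le[OF ka pos(1)] by linarith
  qed
  then have "\<forall>j. \<bar>real_of_int (d $ j)\<bar> \<le> 12 * real T / sqrt (real_of_int (dot a a))" by simp
  then show ?thesis
    unfolding Let_def a_def[symmetric]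
    using \<open>skew p q = wedge a d\<close> ai i A4 di by (intro exI[of _ i] exI[of _ d]) simp
qed

lemma sum_int_abs:
  fixes f :: "nat \<Rightarrow> real"
  shows "(\<Sum>k\<in>{k::int. k \<noteq> 0 \<and> \<bar>k\<bar> \<le> int n}. f (nat \<bar>k\<bar>)) = 2 * (\<Sum>k=1..n. f k)"
proof -
  have eq: "{k::int. k \<noteq> 0 \<and> \<bar>k\<bar> \<le> int n} = int ` {1..n} \<union> (\<lambda>k. - int k) ` {1..n}"
  proof (intro set_eqI iffI)
    fix k :: int assume k: "k \<in> {k::int. k \<noteq> 0 \<and> \<bar>k\<bar> \<le> int n}"
    then have "nat \<bar>k\<bar> \<in> {1..n}" by auto
    moreover have "k = int (nat \<bar>k\<bar>) \<or> k = - int (nat \<bar>k\<bar>)" by auto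
    ultimately show "k \<in> int ` {1..n} \<union> (\<lambda>k. - int k) ` {1..n}" by blast
  qed auto
  have "(\<Sum>k\<in>int ` {1..n} \<union> (\<lambda>k. - int k) ` {1..n}. f (nat \<bar>k\<bar>))
      = (\<Sum>k\<in>int ` {1..n}. f (nat \<bar>k\<bar>)) + (\<Sum>k\<in>(\<lambda>k. - int k) ` {1..n}. f (nat \<bar>k\<bar>))"
    by (rule sum.union_disjoint) auto
  also have "\<dots> = 2 * (\<Sum>k=1..n. f k)"
    by (simp add: sum.reindex inj_on_def)
  finally show ?thesis by (simp add: eq)
qed

text \<open>A vector $a$ is the chosen shortest vector of at most a multiple of $T^3/|a|^2$ lines, so the sum is at most a
multiple of $T^3 \sum_a |a|^{-4}$.  About $k^3$ integer vectors with four coordinates have largest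
coordinate $\pm k$, and what remains is a harmonic sum over $k \le 4T$, of size $T^\epsilon$.\<close>

lemma sum_inverse_shortest:
  fixes \<epsilon> :: real
  assumes "\<epsilon> > 0"
  shows "\<exists>K\<ge>1. \<forall>T::nat. T \<ge> 1 \<longrightarrow>
    (\<Sum>(p, q)\<in>int_lines T. 1 / real_of_int (dot (shortest p q) (shortest p q))) \<le> K * real T powr (3 + \<epsilon>)"
proof -
  \<comment> \<open>four choices of $i$; $36 = 3 \cdot 12$ from the sides of the slab; $27$ from $(2k+1)^3 \le 27 k^3$; two signs of $k$\<close>
  define K where "K = 4 * (36 ^ 3 * 27 * 2) * ((1 + 1 / \<epsilon>) * 4 powr \<epsilon>)"
  have main: "(\<Sum>(p, q)\<in>int_lines T. 1 / real_of_int (dot (shortest p q) (shortest p q))) \<le> K * real T powr (3 + \<epsilon>)"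
    if T: "T \<ge> 1" for T :: nat
  proof -
    define t where "t = real T"
    have t1: "t \<ge> 1" using T by (simp add: t_def)
    define L where "L = (\<lambda>a :: int ^ 4. 12 * t / sqrt (real_of_int (dot a a)))"
    \<comment> \<open>the possible $a$ with largest coordinate $i$, and for each of them the possible second factors\<close>
    define E where "E = (\<lambda>i::4. {a :: int ^ 4. a $ i \<noteq> 0 \<and> (\<forall>j. \<bar>a $ j\<bar> \<le> \<bar>a $ i\<bar>) \<and> dot a a \<le> 4 * int T})"
    define H where "H = (\<lambda>(i::4) (a :: int ^ 4). {c :: int ^ 4. c $ i \<in> {0..<\<bar>a $ i\<bar>} \<and>
        (\<forall>j. j \<noteq> i \<longrightarrow> c $ j \<in> {k. \<bar>real_of_int k\<bar> \<le> L a})})"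
    have finH: "finite (H i a)" for i a
      unfolding H_def by (rule card_vec_slab(1)) auto
    define slab where "slab = (\<lambda>(i::4) k. {a :: int ^ 4. a $ i \<in> {k} \<and> (\<forall>j. j \<noteq> i \<longrightarrow> a $ j \<in> {-\<bar>k\<bar>..\<bar>k\<bar>})})"
    have finslab: "finite (slab i k)" and cslab: "card (slab i k) = (nat (2 * \<bar>k\<bar> + 1)) ^ 3" for i k
      unfolding slab_def using card_vec_slab[of "{k}" "{-\<bar>k\<bar>..\<bar>k\<bar>}" i] by simp_all
    define I where "I = {k::int. k \<noteq> 0 \<and> \<bar>k\<bar> \<le> int (4 * T)}"
    have finI: "finite I" unfolding I_def by (rule finite_subset[of _ "{- int (4 * T)..int (4 * T)}"]) auto
    have keyE: "a $ i \<in> I" "1 \<le> dot a a" "\<bar>real_of_int (a $ i)\<bar> \<le> sqrt (real_of_int (dot a a))" "1 \<le> L a" "a \<in> slab i (a $ i)"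
      if a: "a \<in> E i" for a i
    proof -
      have "a $ i \<noteq> 0" using a by (simp add: E_def)
      then have ne: "1 \<le> \<bar>a $ i\<bar>" by linarith
      have "\<bar>a $ i\<bar> * 1 \<le> \<bar>a $ i\<bar> * \<bar>a $ i\<bar>" using ne by (intro mult_left_mono) auto
      also have "\<dots> = (a $ i)\<^sup>2" by (simp add: power2_eq_square)
      also have sq: "\<dots> \<le> dot a a" by (rule coordinate_sq_le_dot)
      finally have le: "\<bar>a $ i\<bar> \<le> dot a a" by simp
      then show "a $ i \<in> I" using a by (simp add: I_def E_def)
      show d1: "1 \<le> dot a a" using le ne by linarith
      have "sqrt ((real_of_int (a $ i))\<^sup>2) \<le> sqrt (real_of_int (dot a a))"
        using sq by (intro real_sqrt_le_mono) (metis of_int_le_iff of_int_power)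
      then show "\<bar>real_of_int (a $ i)\<bar> \<le> sqrt (real_of_int (dot a a))" by simp
      have "sqrt (real_of_int (dot a a)) \<le> sqrt ((real_of_int (dot a a))\<^sup>2)"
        using d1 by (intro real_sqrt_le_mono self_le_power) auto
      then have "sqrt (real_of_int (dot a a)) \<le> real_of_int (dot a a)" using d1 by simp
      also have "real_of_int (dot a a) \<le> real_of_int (4 * int T)"
        using a by (intro of_int_le_iff[THEN iffD2]) (simp add: E_def)
      also have "\<dots> \<le> 12 * t" by (simp add: t_def)
      finally show "1 \<le> L a" using d1 by (simp add: L_def)
      show "a \<in> slab i (a $ i)" using a unfolding slab_def E_def by (auto simp: abs_le_iff minus_le_iff)
    qed
    have finE: "finite (E i)" for i
    proof (rule finite_subset)
      show "E i \<subseteq> (\<Union>k\<in>I. slab i k)"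
      proof
        fix a assume a: "a \<in> E i"
        show "a \<in> (\<Union>k\<in>I. slab i k)" by (rule UN_I[of "a $ i"]) (fact keyE(1)[OF a] keyE(5)[OF a])+
      qed
      show "finite (\<Union>k\<in>I. slab i k)"
        by (rule finite_UN_I[OF finI finslab])
    qed
    have cH: "real (card (H i a)) * (1 / real_of_int (dot a a)) \<le> 36 ^ 3 * t ^ 3 / real (nat \<bar>a $ i\<bar>) ^ 4"
      if a: "a \<in> E i" for a i
    proof -
      define s where "s = sqrt (real_of_int (dot a a))"
      define u where "u = real (nat \<bar>a $ i\<bar>)"
      have u: "u = \<bar>real_of_int (a $ i)\<bar>" by (simp add: u_def)
      have us: "1 \<le> u" "u \<le> s" using keyE(3)[OF a] a unfolding u s_def by (auto simp: E_def)
      have A: "real_of_int (dot a a) = s ^ 2" using keyE(2)[OF a] by (simp add: s_def)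
      let ?J = "{k::int. \<bar>real_of_int k\<bar> \<le> L a}"
      have "real (card ?J) \<le> 3 * L a" using card_abs_le_real[of "L a"] keyE(4)[OF a] by linarith
      then have "real (card ?J) ^ 3 \<le> (36 * t / s) ^ 3"
        by (intro power_mono) (simp_all add: L_def s_def)
      moreover have "card (H i a) = nat \<bar>a $ i\<bar> * card ?J ^ 3"
        unfolding H_def by (subst card_vec_slab) auto
      ultimately have "real (card (H i a)) \<le> u * (36 * t / s) ^ 3"
        by (simp add: u_def mult_left_mono)
      then have "real (card (H i a)) * (1 / real_of_int (dot a a)) \<le> u * (36 * t / s) ^ 3 * (1 / s ^ 2)"
        unfolding A by (intro mult_right_mono) auto
      also have "\<dots> = 36 ^ 3 * t ^ 3 * (u / s ^ 5)"
        by (simp add: power_divide power_mult_distrib flip: power_add)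
      also have "\<dots> \<le> 36 ^ 3 * t ^ 3 * (u / u ^ 5)"
        using us t1 by (intro mult_left_mono divide_left_mono power_mono) auto
      also have "u / u ^ 5 = 1 / u ^ 4" using us by (simp add: eval_nat_numeral)
      finally show ?thesis by (simp add: u_def)
    qed
    have sumE: "(\<Sum>a\<in>E i. 36 ^ 3 * t ^ 3 / real (nat \<bar>a $ i\<bar>) ^ 4)
        \<le> 36 ^ 3 * t ^ 3 * 27 * 2 * ((1 + 1 / \<epsilon>) * 4 powr \<epsilon> * t powr \<epsilon>)" for i
    proof -
      let ?f = "\<lambda>a :: int ^ 4. 36 ^ 3 * t ^ 3 / real (nat \<bar>a $ i\<bar>) ^ 4"
      have "(\<Sum>a\<in>E i. ?f a) = (\<Sum>k\<in>I. \<Sum>a\<in>{a \<in> E i. a $ i = k}. ?f a)"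
        by (rule sum.group[symmetric]) (use finE finI keyE(1) in auto)
      also have "\<dots> \<le> (\<Sum>k\<in>I. 36 ^ 3 * t ^ 3 * 27 * (1 / real (nat \<bar>k\<bar>)))"
      proof (rule sum_mono)
        fix k assume k: "k \<in> I"
        define u where "u = real (nat \<bar>k\<bar>)"
        have u: "1 \<le> u" using k unfolding u_def I_def by auto
        have "(\<Sum>a\<in>{a \<in> E i. a $ i = k}. ?f a) = real (card {a \<in> E i. a $ i = k}) * (36 ^ 3 * t ^ 3 / u ^ 4)"
          by (simp add: u_def)
        also have "\<dots> \<le> real (card (slab i k)) * (36 ^ 3 * t ^ 3 / u ^ 4)"
          using keyE(5) finslab t1 by (intro mult_right_mono of_nat_mono card_mono) auto
        also have "real (card (slab i k)) = (2 * u + 1) ^ 3"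
          by (simp add: cslab u_def)
        also have "(2 * u + 1) ^ 3 * (36 ^ 3 * t ^ 3 / u ^ 4) \<le> (3 * u) ^ 3 * (36 ^ 3 * t ^ 3 / u ^ 4)"
          using u t1 by (intro mult_right_mono power_mono) auto
        also have "\<dots> = 36 ^ 3 * t ^ 3 * 27 * (1 / u)"
          using u by (simp add: power_mult_distrib eval_nat_numeral)
        finally show "(\<Sum>a\<in>{a \<in> E i. a $ i = k}. ?f a) \<le> 36 ^ 3 * t ^ 3 * 27 * (1 / real (nat \<bar>k\<bar>))"
          by (simp add: u_def)
      qed
      also have "\<dots> = 36 ^ 3 * t ^ 3 * 27 * (\<Sum>k\<in>I. 1 / real (nat \<bar>k\<bar>))"
        by (rule sum_distrib_left[symmetric])
      also have "(\<Sum>k\<in>I. 1 / real (nat \<bar>k\<bar>)) = 2 * (\<Sum>k=1..4 * T. 1 / real k)"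
        unfolding I_def by (rule sum_int_abs)
      also have "36 ^ 3 * t ^ 3 * 27 * (2 * (\<Sum>k=1..4 * T. 1 / real k))
          \<le> 36 ^ 3 * t ^ 3 * 27 * (2 * ((1 + 1 / \<epsilon>) * real (4 * T) powr \<epsilon>))"
        using T t1 assms by (intro mult_left_mono sum_inverse_le_powr) auto
      also have "real (4 * T) powr \<epsilon> = 4 powr \<epsilon> * t powr \<epsilon>"
        by (simp add: t_def powr_mult)
      finally show ?thesis by (simp add: mult_ac)
    qed
    have "\<forall>z\<in>int_lines T. \<exists>i c. skew (fst z) (snd z) = wedge (shortest (fst z) (snd z)) c \<and>
        shortest (fst z) (snd z) \<in> E i \<and> c \<in> H i (shortest (fst z) (snd z))"
    proof
      fix z assume "z \<in> int_lines T"
      then have "(fst z, snd z) \<in> int_lines T" by simp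
      from line_as_wedge[OF this]
      show "\<exists>i c. skew (fst z) (snd z) = wedge (shortest (fst z) (snd z)) c \<and>
        shortest (fst z) (snd z) \<in> E i \<and> c \<in> H i (shortest (fst z) (snd z))"
        unfolding Let_def E_def H_def L_def t_def by (elim exE) (intro exI, auto)
    qed
    then obtain idx co where ic: "\<And>z. z \<in> int_lines T \<Longrightarrow>
        skew (fst z) (snd z) = wedge (shortest (fst z) (snd z)) (co z) \<and>
        shortest (fst z) (snd z) \<in> E (idx z) \<and> co z \<in> H (idx z) (shortest (fst z) (snd z))"
      by metis
    define g where "g = (\<lambda>z. (idx z, (shortest (fst z) (snd z), co z)))"
    define D where "D = Sigma UNIV (\<lambda>i. Sigma (E i) (H i))"
    define w where "w = (\<lambda>(i::4, (a :: int ^ 4, c :: int ^ 4)). 1 / real_of_int (dot a a))"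
    have inj: "inj_on g (int_lines T)"
    proof (rule inj_onI)
      fix z z' assume z: "z \<in> int_lines T" "z' \<in> int_lines T" "g z = g z'"
      then have "skew (fst z) (snd z) = skew (fst z') (snd z')"
        using ic[of z] ic[of z'] by (simp add: g_def)
      then show "z = z'" unfolding skew_eq_iff by (simp add: prod_eq_iff)
    qed
    have finD: "finite D" unfolding D_def using finE finH by (intro finite_SigmaI) auto
    have "(\<Sum>(p, q)\<in>int_lines T. 1 / real_of_int (dot (shortest p q) (shortest p q)))
        = (\<Sum>z\<in>int_lines T. w (g z))"
      by (simp add: w_def g_def case_prod_unfold)
    also have "\<dots> = sum w (g ` int_lines T)"
      using inj by (simp add: sum.reindex)
    also have "\<dots> \<le> sum w D"
      using ic finD by (intro sum_mono2) (auto simp: D_def g_def w_def dot_self_nonneg)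
    also have "\<dots> = (\<Sum>i\<in>UNIV. \<Sum>z\<in>Sigma (E i) (H i). w (i, z))"
      unfolding D_def using finE finH by (subst sum.Sigma) (auto simp: case_prod_unfold)
    also have "\<dots> = (\<Sum>i\<in>UNIV. \<Sum>a\<in>E i. \<Sum>c\<in>H i a. w (i, (a, c)))"
    proof (rule sum.cong)
      fix i :: 4
      show "(\<Sum>z\<in>Sigma (E i) (H i). w (i, z)) = (\<Sum>a\<in>E i. \<Sum>c\<in>H i a. w (i, (a, c)))"
        using finE finH by (subst sum.Sigma) (auto simp: case_prod_unfold)
    qed simp
    also have "\<dots> = (\<Sum>i\<in>UNIV. \<Sum>a\<in>E i. real (card (H i a)) * (1 / real_of_int (dot a a)))"
      by (simp add: w_def)
    also have "\<dots> \<le> (\<Sum>i\<in>UNIV. \<Sum>a\<in>E i. 36 ^ 3 * t ^ 3 / real (nat \<bar>a $ i\<bar>) ^ 4)"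
      by (intro sum_mono cH)
    also have "\<dots> \<le> (\<Sum>i\<in>(UNIV::4 set). 36 ^ 3 * t ^ 3 * 27 * 2 * ((1 + 1 / \<epsilon>) * 4 powr \<epsilon> * t powr \<epsilon>))"
      by (intro sum_mono sumE)
    also have "\<dots> = K * (t ^ 3 * t powr \<epsilon>)"
      by (simp add: K_def mult_ac)
    also have "t ^ 3 * t powr \<epsilon> = t powr (3 + \<epsilon>)"
      using t1 by (simp add: powr_add)
    finally show ?thesis by (simp add: t_def)
  qed
  have "1 \<le> K"
  proof -
    have "1 * (1 * 1) \<le> (4 * (36 ^ 3 * 27 * 2)) * ((1 + 1 / \<epsilon>) * 4 powr \<epsilon>)"
      using assms by (intro mult_mono) (auto intro: ge_one_powr_ge_zero)
    then show ?thesis by (simp add: K_def)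
  qed
  then show ?thesis using main by blast
qed

definition meeting_pairs :: "nat \<Rightarrow> nat \<Rightarrow> (((int ^ 3) \<times> (int ^ 3)) \<times> ((int ^ 3) \<times> (int ^ 3))) set" where
  "meeting_pairs R T = {((x, y), (p, q)). x \<in> int_box R \<and> y \<in> int_box R \<and> p \<in> int_box T \<and> q \<in> int_box T \<and>
     dot x y = 0 \<and> dot p q = 0 \<and> dot x q + dot y p = 0}"

lemma finite_meeting_pairs: "finite (meeting_pairs R T)"
  by (rule finite_subset[of _ "(int_box R \<times> int_box R) \<times> (int_box T \<times> int_box T)"])
     (auto simp: meeting_pairs_def finite_int_box)

lemma card_meeting_pairs_commute: "card (meeting_pairs R T) = card (meeting_pairs T R)"
proof (rule bij_betw_same_card)
  show "bij_betw prod.swap (meeting_pairs R T) (meeting_pairs T R)"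
    by (rule bij_betwI[of _ _ _ prod.swap]) (auto simp: meeting_pairs_def dot_commute add.commute)
qed

lemma int_lines_swap: "prod.swap ` int_lines T = int_lines T"
proof -
  have "skew q p = 0 \<longleftrightarrow> skew p q = 0" for p q
    using sq_norm_skew_dual[of p q] sq_norm_eq_0_iff by metis
  then have "prod.swap ` int_lines T \<subseteq> int_lines T"
    by (auto simp: int_lines_def dot_commute)
  moreover from this have "prod.swap ` prod.swap ` int_lines T \<subseteq> prod.swap ` int_lines T"
    by (rule image_mono)
  ultimately show ?thesis by (simp add: image_image)
qed

text \<open>The pairs with $(p, q) = (0, 0)$ contribute all lines $(x, y)$.  For the others, the bound for the lines meeting a
fixed line is summed over that line; its two terms have the same sum because duality permutes the
lines.\<close>

lemma card_meeting_pairs: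
  fixes \<epsilon> :: real
  assumes "\<epsilon> > 0"
  shows "\<exists>K\<ge>1. \<forall>R T::nat. T \<ge> 1 \<longrightarrow> T \<le> R \<longrightarrow>
    real (card (meeting_pairs R T)) \<le> K * (real R powr (4 + \<epsilon>) + real R powr (3 + \<epsilon>) * real T powr (3 + \<epsilon>))"
proof -
  obtain K1 where K1: "K1 \<ge> 1" "\<forall>R::nat. R \<ge> 1 \<longrightarrow>
    finite {(x :: int ^ 3, y). x \<in> int_box R \<and> y \<in> int_box R \<and> dot x y = 0} \<and>
    real (card {(x :: int ^ 3, y). x \<in> int_box R \<and> y \<in> int_box R \<and> dot x y = 0}) \<le> K1 * real R powr (4 + \<epsilon>)"
    using card_isotropic[OF assms] by (elim exE conjE) (rule that)
  obtain K2 where K2: "K2 \<ge> 1" "\<forall>R T p q a c b d. 1 \<le> T \<longrightarrow> T \<le> R \<longrightarrow> p \<in> int_box T \<longrightarrow> q \<in> int_box T \<longrightarrow>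
      dot p q = 0 \<longrightarrow> skew p q \<noteq> 0 \<longrightarrow> reduced_basis p q a c \<longrightarrow> reduced_basis q p b d \<longrightarrow>
      real (card (meeting_lines R p q))
        \<le> K2 * real R powr (3 + \<epsilon>) * (1 / real_of_int (dot a a) + 1 / real_of_int (dot b b))"
    using card_meeting_lines[OF assms] by (elim exE conjE) (rule that)
  obtain K3 where K3: "K3 \<ge> 1" "\<forall>T::nat. T \<ge> 1 \<longrightarrow>
    (\<Sum>(p, q)\<in>int_lines T. 1 / real_of_int (dot (shortest p q) (shortest p q))) \<le> K3 * real T powr (3 + \<epsilon>)"
    using sum_inverse_shortest[OF assms] by (elim exE conjE) (rule that)
  define K where "K = K1 + 2 * (K2 * K3)"
  have K23: "1 \<le> K2 * K3" using K2(1) K3(1) mult_mono[of 1 K2 1 K3] by simp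
  have main: "real (card (meeting_pairs R T)) \<le> K * (real R powr (4 + \<epsilon>) + real R powr (3 + \<epsilon>) * real T powr (3 + \<epsilon>))"
    if T: "T \<ge> 1" "T \<le> R" for R T
  proof -
    define Z where "Z = {(x :: int ^ 3, y). x \<in> int_box R \<and> y \<in> int_box R \<and> dot x y = 0}"
    define w where "w = (\<lambda>z. 1 / real_of_int (dot (shortest (fst z) (snd z)) (shortest (fst z) (snd z))))"
    define G where "G = Sigma (int_lines T) (\<lambda>z. meeting_lines R (fst z) (snd z))"
    have Z: "finite Z" "real (card Z) \<le> K1 * real R powr (4 + \<epsilon>)"
      using K1(2) T unfolding Z_def by auto
    have finG: "finite G" unfolding G_def using finite_int_lines finite_meeting_lines by (intro finite_SigmaI) auto
    \<comment> \<open>the factors of $G$ come in the opposite order, since the sum runs over the line $(p, q)$\<close>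
    have "meeting_pairs R T \<subseteq> Z \<times> {(0, 0)} \<union> prod.swap ` G"
    proof
      fix s assume "s \<in> meeting_pairs R T"
      then obtain x y p q where s: "s = ((x, y), (p, q))" and m: "((x, y), (p, q)) \<in> meeting_pairs R T"
        by (metis surj_pair)
      show "s \<in> Z \<times> {(0, 0)} \<union> prod.swap ` G"
      proof (cases "skew p q = 0")
        case True
        then have "skew p q = skew 0 0" by (simp add: vec_eq_iff forall_4 skew_nth)
        then have "p = 0" "q = 0" unfolding skew_eq_iff by simp_all
        then show ?thesis using m unfolding s Z_def meeting_pairs_def by simp
      next
        case False
        then have "((p, q), (x, y)) \<in> G"
          using m unfolding G_def int_lines_def meeting_lines_def meeting_pairs_def by simp
        then have "prod.swap ((p, q), (x, y)) \<in> prod.swap ` G" by (rule imageI)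
        then show ?thesis unfolding s by simp
      qed
    qed
    then have "card (meeting_pairs R T) \<le> card (Z \<times> {(0 :: int ^ 3, 0 :: int ^ 3)} \<union> prod.swap ` G)"
      using Z(1) finG by (intro card_mono) auto
    also have "\<dots> \<le> card (Z \<times> {(0 :: int ^ 3, 0 :: int ^ 3)}) + card (prod.swap ` G)"
      by (rule card_Un_le)
    also have "\<dots> \<le> card Z + card G"
      using card_image_le[OF finG, of prod.swap] by (simp add: card_cartesian_product)
    finally have "real (card (meeting_pairs R T)) \<le> real (card Z) + real (card G)" by linarith
    moreover have "real (card G) \<le> 2 * (K2 * K3) * (real R powr (3 + \<epsilon>) * real T powr (3 + \<epsilon>))"
    proof -
      have "card G = (\<Sum>z\<in>int_lines T. card (meeting_lines R (fst z) (snd z)))"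
        unfolding G_def by (rule card_SigmaI) (simp_all add: finite_int_lines finite_meeting_lines)
      then have "real (card G) = (\<Sum>z\<in>int_lines T. real (card (meeting_lines R (fst z) (snd z))))" by simp
      also have "\<dots> \<le> (\<Sum>z\<in>int_lines T. K2 * real R powr (3 + \<epsilon>) * (w z + w (prod.swap z)))"
      proof (rule sum_mono)
        fix z assume z: "z \<in> int_lines T"
        then have z': "prod.swap z \<in> int_lines T" using int_lines_swap by blast
        obtain c where c: "reduced_basis (fst z) (snd z) (shortest (fst z) (snd z)) c"
          using shortest[of "fst z" "snd z"] z by auto
        obtain d where d: "reduced_basis (snd z) (fst z) (shortest (snd z) (fst z)) d"
          using shortest[of "snd z" "fst z"] z' by (cases z) auto
        have "fst z \<in> int_box T" "snd z \<in> int_box T" "dot (fst z) (snd z) = 0" "skew (fst z) (snd z) \<noteq> 0"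
          using z by (auto simp: int_lines_def)
        then show "real (card (meeting_lines R (fst z) (snd z))) \<le> K2 * real R powr (3 + \<epsilon>) * (w z + w (prod.swap z))"
          using K2(2)[rule_format, OF T _ _ _ _ c d] unfolding w_def by simp
      qed
      also have "\<dots> = K2 * real R powr (3 + \<epsilon>) * ((\<Sum>z\<in>int_lines T. w z) + (\<Sum>z\<in>int_lines T. w (prod.swap z)))"
        by (simp add: sum_distrib_left sum.distrib distrib_left)
      also have "(\<Sum>z\<in>int_lines T. w (prod.swap z)) = (\<Sum>z\<in>int_lines T. w z)"
      proof -
        have "(\<Sum>z\<in>int_lines T. w (prod.swap z)) = sum w (prod.swap ` int_lines T)"
          by (subst sum.reindex) auto
        then show ?thesis by (simp add: int_lines_swap)
      qed
      also have "K2 * real R powr (3 + \<epsilon>) * ((\<Sum>z\<in>int_lines T. w z) + (\<Sum>z\<in>int_lines T. w z))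
          \<le> K2 * real R powr (3 + \<epsilon>) * (K3 * real T powr (3 + \<epsilon>) + K3 * real T powr (3 + \<epsilon>))"
        using K3(2) T(1) K2(1) unfolding w_def case_prod_unfold
        by (intro mult_left_mono add_mono) auto
      finally show ?thesis by (simp add: algebra_simps)
    qed
    moreover have "K1 * real R powr (4 + \<epsilon>) \<le> K * real R powr (4 + \<epsilon>)"
      "2 * (K2 * K3) * (real R powr (3 + \<epsilon>) * real T powr (3 + \<epsilon>)) \<le> K * (real R powr (3 + \<epsilon>) * real T powr (3 + \<epsilon>))"
      using K1(1) K23 by (intro mult_right_mono; simp add: K_def)+
    ultimately show ?thesis using Z(2) unfolding distrib_left by linarith
  qed
  have "1 \<le> K" using K1(1) K23 by (simp add: K_def)
  then show ?thesis using main by blast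
qed

section \<open>Orthogonality of characters\<close>

lemma e_unit_0 [simp]: "e_unit 0 = 1"
  by (simp add: e_unit_def)

lemma e_unit_add: "e_unit (s + t) = e_unit s * e_unit t"
  by (simp add: e_unit_def distrib_left exp_add)

lemma e_unit_sum: "finite A \<Longrightarrow> e_unit (\<Sum>j\<in>A. f j) = (\<Prod>j\<in>A. e_unit (f j))"
  by (induction A rule: finite_induct) (simp_all add: e_unit_add)

lemma e_unit_int [simp]: "e_unit (real_of_int k) = 1"
proof -
  have "2 * complex_of_real pi * \<i> * complex_of_real (real_of_int k) = \<i> * (of_int k * (of_real pi * 2))"
    by simp
  then show ?thesis unfolding e_unit_def by (simp only: exp_2pi_1_int)
qed

lemma cnj_e_unit: "cnj (e_unit t) = e_unit (- t)"
  by (simp add: e_unit_def exp_cnj)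

lemma continuous_on_e_unit [continuous_intros]:
  "continuous_on S f \<Longrightarrow> continuous_on S (\<lambda>x. e_unit (f x))"
  unfolding e_unit_def by (intro continuous_intros)

lemma integral_e_unit:
  fixes k :: int
  shows "integrable lborel (\<lambda>t. indicator {0..1} t *\<^sub>R e_unit (real_of_int k * t))"
    and "(LINT t|lborel. indicator {0..1} t *\<^sub>R e_unit (real_of_int k * t)) = (if k = 0 then 1 else 0)"
proof -
  show "integrable lborel (\<lambda>t. indicator {0..1} t *\<^sub>R e_unit (real_of_int k * t))"
    by (intro borel_integrable_compact continuous_intros) auto
  show "(LINT t|lborel. indicator {0..1} t *\<^sub>R e_unit (real_of_int k * t)) = (if k = 0 then 1 else 0)"
  proof (cases "k = 0")
    case True
    have "(LINT t|lborel. indicator {0..1::real} t *\<^sub>R (1::complex)) = 1"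
      by simp
    then show ?thesis using True by simp
  next
    case False
    define w where "w = 2 * complex_of_real pi * \<i> * of_int k"
    have w: "w \<noteq> 0" using False by (simp add: w_def)
    have ew: "e_unit (real_of_int k * t) = exp (w * of_real t)" for t
      by (simp add: e_unit_def w_def mult_ac)
    have der: "((\<lambda>t. exp (w * of_real t) / w) has_vector_derivative exp (w * of_real t)) (at t within {0..1})" for t :: real
    proof -
      have "((\<lambda>z. exp (w * z) / w) has_field_derivative exp (w * of_real t)) (at (of_real t))"
        using w by (auto intro!: derivative_eq_intros)
      then show ?thesis by (rule has_vector_derivative_real_field)
    qed
    have "(LINT t|lborel. indicator {0..1} t *\<^sub>R exp (w * of_real t)) = exp (w * of_real 1) / w - exp (w * of_real 0) / w"
      by (rule integral_FTC_Icc) (use der in \<open>auto intro!: continuous_intros\<close>)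
    also have "exp (w * of_real 1) = 1" using ew[of 1] by simp
    finally show ?thesis using False by (simp add: ew)
  qed
qed

text \<open>Fubini for products of functions of single coordinates, read off from the construction of the
Lebesgue measure as a product measure.\<close>

lemma lborel_integral_prod:
  fixes f :: "'a::euclidean_space \<Rightarrow> real \<Rightarrow> complex"
  assumes int: "\<And>b. b \<in> Basis \<Longrightarrow> integrable lborel (f b)"
  shows "(LINT x|lborel. (\<Prod>b\<in>Basis. f b (x \<bullet> b))) = (\<Prod>b\<in>Basis. (LINT t|lborel. f b t))"
proof -
  interpret product_sigma_finite "\<lambda>_::'a. lborel :: real measure"
    by standard
  have meas: "f b \<in> borel_measurable borel" if "b \<in> Basis" for b
    using borel_measurable_integrable[OF int[OF that]] by simp
  have "(LINT x|lborel. (\<Prod>b\<in>Basis. f b (x \<bullet> b)))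
      = (LINT g|Pi\<^sub>M Basis (\<lambda>_. lborel). (\<Prod>b\<in>Basis. f b ((\<Sum>b\<in>Basis. g b *\<^sub>R b) \<bullet> b)))"
    by (subst lborel_eq, rule integral_distr)
       (auto intro!: borel_measurable_prod measurable_compose[OF _ meas])
  also have "\<dots> = (LINT g|Pi\<^sub>M Basis (\<lambda>_. lborel). (\<Prod>b\<in>Basis. f b (g b)))"
    by (intro Bochner_Integration.integral_cong prod.cong refl) (simp add: inner_sum_left_Basis)
  also have "\<dots> = (\<Prod>b\<in>Basis. (LINT t|lborel. f b t))"
    by (rule product_integral_prod) (auto intro: int)
  finally show ?thesis .
qed

definition phase :: "int ^ 'n \<Rightarrow> real ^ 'n \<Rightarrow> real" where
  "phase m x = (\<Sum>j\<in>UNIV. real_of_int (m $ j) * x $ j)"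

lemma continuous_on_phase [continuous_intros]: "continuous_on S (phase m)"
  unfolding phase_def by (intro continuous_intros)

lemma phase_diff: "phase (m - m') x = phase m x - phase m' x"
  by (simp add: phase_def left_diff_distrib sum_subtractf)

lemma phase_add: "phase (m + m') x = phase m x + phase m' x"
  by (simp add: phase_def distrib_right sum.distrib)

text \<open>The integrand is a product of one-dimensional characters, and each of these integrates to zero over a period
unless it is constant.\<close>

lemma integral_e_unit_phase:
  fixes m :: "int ^ 'n"
  shows "(LINT x|lborel. indicator (cbox 0 1) x *\<^sub>R e_unit (phase m x)) = (if m = 0 then 1 else 0)"
proof -
  \<comment> \<open>the basis is a set of vectors, so the index $j$ has to be recovered from the vector $b = e_j$\<close>
  define f where "f = (\<lambda>(b :: real ^ 'n) t. indicator {0..1} t *\<^sub>R e_unit (real_of_int (m $ (SOME j. b = axis j 1)) * t))"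
  have idx: "(SOME j. axis i (1::real) = axis j 1) = i" for i :: 'n
    by (rule some_equality) (auto simp: axis_eq_axis)
  have prod_Basis: "(\<Prod>b\<in>Basis. g b) = (\<Prod>j\<in>UNIV. g (axis j 1))" for g :: "real ^ 'n \<Rightarrow> complex"
  proof -
    have "(Basis :: (real ^ 'n) set) = (\<lambda>j. axis j 1) ` UNIV"
      by (auto simp: Basis_vec_def)
    then have "prod g Basis = prod g ((\<lambda>j. axis j 1) ` UNIV)" by metis
    also have "\<dots> = prod (g \<circ> (\<lambda>j. axis j 1)) UNIV"
      by (rule prod.reindex) (simp add: inj_on_def axis_eq_axis)
    finally show ?thesis by simp
  qed
  have "indicator (cbox 0 1) x *\<^sub>R e_unit (phase m x) = (\<Prod>b\<in>Basis. f b (x \<bullet> b))" for x :: "real ^ 'n"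
  proof -
    have "(\<Prod>b\<in>Basis. f b (x \<bullet> b)) = (\<Prod>j\<in>UNIV. indicator {0..1} (x $ j) *\<^sub>R e_unit (real_of_int (m $ j) * x $ j))"
      unfolding prod_Basis f_def idx by (simp add: inner_axis)
    also have "\<dots> = (\<Prod>j\<in>UNIV. of_real (indicator {0..1} (x $ j))) * e_unit (phase m x)"
      by (simp add: phase_def e_unit_sum scaleR_conv_of_real prod.distrib)
    also have "(\<Prod>j\<in>UNIV. complex_of_real (indicator {0..1} (x $ j))) = of_real (indicator (cbox 0 1) x)"
    proof (cases "x \<in> cbox 0 1")
      case True
      then have "x $ j \<in> {0..1}" for j by (simp add: mem_box_cart)
      then show ?thesis using True by simp
    next
      case False
      then obtain j where "x $ j \<notin> {0..1}" by (auto simp: mem_box_cart)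
      then have "indicator {0..1::real} (x $ j) = (0::real)" by simp
      then have "(\<Prod>j\<in>UNIV. complex_of_real (indicator {0..1} (x $ j))) = 0"
        by (intro prod_zero) (auto intro!: bexI[of _ j])
      then show ?thesis using False by simp
    qed
    finally show ?thesis by (simp add: scaleR_conv_of_real)
  qed
  then have "(LINT x|lborel. indicator (cbox 0 1) x *\<^sub>R e_unit (phase m x)) = (\<Prod>b\<in>Basis. (LINT t|lborel. f b t))"
    using lborel_integral_prod[of f] integral_e_unit(1) by (simp add: f_def)
  also have "\<dots> = (\<Prod>j\<in>UNIV. if m $ j = 0 then 1 else 0)"
    unfolding prod_Basis f_def idx integral_e_unit(2) ..
  also have "\<dots> = (if m = 0 then 1 else 0)"
  proof (cases "m = 0")
    case False
    then obtain j where "m $ j \<noteq> 0" by (auto simp: vec_eq_iff)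
    then show ?thesis using False by (auto intro!: prod_zero bexI[of _ j])
  qed simp
  finally show ?thesis .
qed

text \<open>Expanding the square gives a double sum of characters, and only the trivial ones survive
integration.\<close>

lemma integral_norm_sq_exponential_sum:
  fixes \<phi> :: "'t \<Rightarrow> int ^ 'n"
  assumes "finite T"
  shows "(LINT x|lborel. indicator (cbox 0 1) x *\<^sub>R (norm (\<Sum>\<tau>\<in>T. e_unit (phase (\<phi> \<tau>) x)))\<^sup>2)
       = real (card {(\<tau>, \<tau>'). \<tau> \<in> T \<and> \<tau>' \<in> T \<and> \<phi> \<tau> = \<phi> \<tau>'})"
proof -
  let ?S = "\<lambda>x. \<Sum>\<tau>\<in>T. e_unit (phase (\<phi> \<tau>) x)"
  have sq: "complex_of_real ((norm (?S x))\<^sup>2) = (\<Sum>(\<tau>, \<tau>')\<in>T \<times> T. e_unit (phase (\<phi> \<tau> - \<phi> \<tau>') x))" for x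
  proof -
    have "complex_of_real ((norm (?S x))\<^sup>2) = ?S x * cnj (?S x)"
      by (rule complex_norm_square)
    also have "\<dots> = (\<Sum>\<tau>\<in>T. \<Sum>\<tau>'\<in>T. e_unit (phase (\<phi> \<tau>) x) * e_unit (- phase (\<phi> \<tau>') x))"
      by (simp add: cnj_e_unit sum_product)
    also have "\<dots> = (\<Sum>\<tau>\<in>T. \<Sum>\<tau>'\<in>T. e_unit (phase (\<phi> \<tau> - \<phi> \<tau>') x))"
      by (simp add: phase_diff flip: e_unit_add)
    finally show ?thesis by (simp add: sum.cartesian_product)
  qed
  have int: "integrable lborel (\<lambda>x. indicator (cbox 0 1) x *\<^sub>R e_unit (phase m x))" for m :: "int ^ 'n"
    by (intro borel_integrable_compact continuous_intros) auto
  have "complex_of_real (LINT x|lborel. indicator (cbox 0 1) x *\<^sub>R (norm (?S x))\<^sup>2)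
      = (LINT x|lborel. complex_of_real (indicator (cbox 0 1) x *\<^sub>R (norm (?S x))\<^sup>2))"
    by (rule integral_complex_of_real[symmetric])
  also have "\<dots> = (LINT x|lborel. (\<Sum>(\<tau>, \<tau>')\<in>T \<times> T. indicator (cbox 0 1) x *\<^sub>R e_unit (phase (\<phi> \<tau> - \<phi> \<tau>') x)))"
  proof (intro Bochner_Integration.integral_cong refl)
    fix x
    have "complex_of_real (indicator (cbox 0 1) x *\<^sub>R (norm (?S x))\<^sup>2)
        = of_real (indicator (cbox 0 1) x) * complex_of_real ((norm (?S x))\<^sup>2)"
      by simp
    also have "\<dots> = (\<Sum>(\<tau>, \<tau>')\<in>T \<times> T. indicator (cbox 0 1) x *\<^sub>R e_unit (phase (\<phi> \<tau> - \<phi> \<tau>') x))"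
      unfolding sq by (simp add: sum_distrib_left case_prod_unfold scaleR_conv_of_real)
    finally show "complex_of_real (indicator (cbox 0 1) x *\<^sub>R (norm (?S x))\<^sup>2)
        = (\<Sum>(\<tau>, \<tau>')\<in>T \<times> T. indicator (cbox 0 1) x *\<^sub>R e_unit (phase (\<phi> \<tau> - \<phi> \<tau>') x))" .
  qed
  also have "\<dots> = (\<Sum>(\<tau>, \<tau>')\<in>T \<times> T. (LINT x|lborel. indicator (cbox 0 1) x *\<^sub>R e_unit (phase (\<phi> \<tau> - \<phi> \<tau>') x)))"
    unfolding case_prod_unfold by (rule Bochner_Integration.integral_sum) (rule int)
  also have "\<dots> = (\<Sum>(\<tau>, \<tau>')\<in>T \<times> T. if \<phi> \<tau> = \<phi> \<tau>' then 1 else 0)"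
    by (simp add: integral_e_unit_phase)
  also have "\<dots> = of_nat (card {z \<in> T \<times> T. \<phi> (fst z) = \<phi> (snd z)})"
    using sum.inter_filter[of "T \<times> T" "\<lambda>_. 1 :: complex" "\<lambda>z. \<phi> (fst z) = \<phi> (snd z)"] assms
    by (simp add: case_prod_unfold)
  also have "{z \<in> T \<times> T. \<phi> (fst z) = \<phi> (snd z)} = {(\<tau>, \<tau>'). \<tau> \<in> T \<and> \<tau>' \<in> T \<and> \<phi> \<tau> = \<phi> \<tau>'}"
    by auto
  also have "of_nat (card {(\<tau>, \<tau>'). \<tau> \<in> T \<and> \<tau>' \<in> T \<and> \<phi> \<tau> = \<phi> \<tau>'})
      = complex_of_real (real (card {(\<tau>, \<tau>'). \<tau> \<in> T \<and> \<tau>' \<in> T \<and> \<phi> \<tau> = \<phi> \<tau>'}))"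
    by (rule of_real_of_nat_eq[symmetric])
  finally show ?thesis by (rule of_real_eq_iff[THEN iffD1])
qed

lemma exhaust_5: "x = 1 \<or> x = 2 \<or> x = 3 \<or> x = 4 \<or> x = 5" for x :: 5
proof (induct x)
  case (of_int z)
  then have "z = 0 \<or> z = 1 \<or> z = 2 \<or> z = 3 \<or> z = 4" by fastforce
  then show ?case by auto
qed

lemma UNIV_5: "UNIV = {1, 2, 3, 4, 5 :: 5}"
  using exhaust_5 by auto

lemma sum_5: "sum f (UNIV :: 5 set) = f 1 + f 2 + f 3 + f 4 + f 5"
  unfolding UNIV_5 by (simp add: ac_simps)

text \<open>The frequency vector of the grid point $(n, m)$.\<close>

definition monomials :: "int \<Rightarrow> int \<Rightarrow> int ^ 5" where
  "monomials n m = (\<chi> j. if j = 1 then n else if j = 2 then m else if j = 3 then n * m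
     else if j = 4 then n\<^sup>2 else m\<^sup>2)"

lemma monomials_nth:
  "monomials n m $ 1 = n" "monomials n m $ 2 = m" "monomials n m $ 3 = n * m"
  "monomials n m $ 4 = n\<^sup>2" "monomials n m $ 5 = m\<^sup>2"
  by (simp_all add: monomials_def)

definition grid :: "nat \<Rightarrow> nat \<Rightarrow> (int \<times> int) set" where
  "grid N M = {1..int N} \<times> {1..int M}"

lemma exp_sum_eq: "exp_sum N M x = (\<Sum>w\<in>grid N M. e_unit (phase (monomials (fst w) (snd w)) x))"
proof -
  have ph: "phase (monomials n m) x = of_int n * x $ 1 + of_int m * x $ 2 + of_int n * of_int m * x $ 3
      + (of_int n)\<^sup>2 * x $ 4 + (of_int m)\<^sup>2 * x $ 5" for n m
    by (simp add: phase_def sum_5 monomials_nth)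
  have im: "int ` {1..K} = {1..int K}" for K
    by (simp add: image_int_atLeastAtMost)
  have re: "(\<Sum>n\<in>{1..int K}. f n) = (\<Sum>n=1..K. f (int n))" for f :: "int \<Rightarrow> complex" and K
  proof -
    have "(\<Sum>n\<in>int ` {1..K}. f n) = (\<Sum>n=1..K. f (int n))"
      by (subst sum.reindex) (simp_all add: o_def)
    then show ?thesis unfolding im .
  qed
  have "(\<Sum>w\<in>grid N M. e_unit (phase (monomials (fst w) (snd w)) x))
      = (\<Sum>n\<in>{1..int N}. \<Sum>m\<in>{1..int M}. e_unit (phase (monomials n m) x))"
    by (simp add: grid_def sum.cartesian_product case_prod_unfold)
  also have "\<dots> = (\<Sum>n=1..N. \<Sum>m=1..M. e_unit (phase (monomials (int n) (int m)) x))"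
    unfolding re ..
  finally show ?thesis by (simp add: exp_sum_def ph)
qed

type_synonym quadruple = "((int \<times> int) \<times> (int \<times> int)) \<times> ((int \<times> int) \<times> (int \<times> int))"

definition moments :: "quadruple \<Rightarrow> int ^ 5" where
  "moments = (\<lambda>((w1, w2), (w3, w4)). monomials (fst w1) (snd w1) + monomials (fst w2) (snd w2)
     + (monomials (fst w3) (snd w3) + monomials (fst w4) (snd w4)))"

definition quadruples :: "nat \<Rightarrow> nat \<Rightarrow> quadruple set" where
  "quadruples N M = (grid N M \<times> grid N M) \<times> (grid N M \<times> grid N M)"

lemma quadruple_cases:
  fixes \<tau> :: quadruple
  obtains n1 m1 n2 m2 n3 m3 n4 m4 where "\<tau> = (((n1, m1), (n2, m2)), ((n3, m3), (n4, m4)))"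
  by (rule that[of "fst (fst (fst \<tau>))" "snd (fst (fst \<tau>))" "fst (snd (fst \<tau>))" "snd (snd (fst \<tau>))"
        "fst (fst (snd \<tau>))" "snd (fst (snd \<tau>))" "fst (snd (snd \<tau>))" "snd (snd (snd \<tau>))"]) simp

lemma finite_quadruples: "finite (quadruples N M)"
  by (simp add: quadruples_def grid_def)

lemma exp_sum_pow_4: "exp_sum N M x ^ 4 = (\<Sum>\<tau>\<in>quadruples N M. e_unit (phase (moments \<tau>) x))"
proof -
  let ?W = "grid N M"
  let ?e = "\<lambda>w. e_unit (phase (monomials (fst w) (snd w)) x)"
  have sq: "(\<Sum>w\<in>A. f w) * (\<Sum>w\<in>B. g w) = (\<Sum>(v, w)\<in>A \<times> B. f v * g w)"
    for A :: "'c set" and B :: "'d set" and f g :: "_ \<Rightarrow> complex"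
    by (simp add: sum_product sum.cartesian_product)
  have "exp_sum N M x ^ 4 = ((\<Sum>w\<in>?W. ?e w) * (\<Sum>w\<in>?W. ?e w)) * ((\<Sum>w\<in>?W. ?e w) * (\<Sum>w\<in>?W. ?e w))"
    by (simp add: exp_sum_eq power4_eq_xxxx mult.assoc)
  also have "\<dots> = (\<Sum>((w1, w2), (w3, w4))\<in>(?W \<times> ?W) \<times> (?W \<times> ?W). (?e w1 * ?e w2) * (?e w3 * ?e w4))"
    unfolding sq by (simp add: case_prod_unfold)
  also have "\<dots> = (\<Sum>\<tau>\<in>quadruples N M. e_unit (phase (moments \<tau>) x))"
    unfolding quadruples_def
    by (intro sum.cong refl) (auto simp: moments_def phase_add e_unit_add)
  finally show ?thesis .
qed

text \<open>The eighth power of the absolute value is the square of that of the fourth power, which is an exponential sum over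
quadruples of grid points.\<close>

lemma Lp_norm_exp_sum:
  "Lp_norm 8 (cbox 0 1) (exp_sum N M) ^ 8
     = real (card {(\<tau>, \<tau>'). \<tau> \<in> quadruples N M \<and> \<tau>' \<in> quadruples N M \<and> moments \<tau> = moments \<tau>'})"
proof -
  define I where "I = (LINT x:cbox 0 1|lebesgue. norm (exp_sum N M x) powr 8)"
  have I0: "0 \<le> I"
    unfolding I_def set_lebesgue_integral_def by (intro Bochner_Integration.integral_nonneg) simp
  have "Lp_norm 8 (cbox 0 1) (exp_sum N M) ^ 8 = I"
  proof -
    have "(I powr (1 / 8)) ^ 8 = I"
    proof (cases "I = 0")
      case False
      then have "(I powr (1 / 8)) ^ 8 = I powr (real 8 * (1 / 8))"
        by (intro powr_power) simp
      then show ?thesis using I0 by simp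
    qed simp
    then show ?thesis by (simp add: Lp_norm_def I_def)
  qed
  also have "I = (LINT x|lebesgue. indicator (cbox 0 1) x *\<^sub>R (norm (\<Sum>\<tau>\<in>quadruples N M. e_unit (phase (moments \<tau>) x)))\<^sup>2)"
  proof -
    have "norm (exp_sum N M x) powr 8 = (norm (exp_sum N M x ^ 4))\<^sup>2" for x
      by (simp add: norm_power powr_numeral flip: power_mult)
    then show ?thesis unfolding I_def set_lebesgue_integral_def exp_sum_pow_4 by simp
  qed
  also have "\<dots> = (LINT x|lborel. indicator (cbox 0 1) x *\<^sub>R (norm (\<Sum>\<tau>\<in>quadruples N M. e_unit (phase (moments \<tau>) x)))\<^sup>2)"
  proof (rule integral_completion)
    have "continuous_on UNIV (\<lambda>x. (norm (\<Sum>\<tau>\<in>quadruples N M. e_unit (phase (moments \<tau>) x)))\<^sup>2)"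
      by (intro continuous_intros)
    then have "(\<lambda>x. (norm (\<Sum>\<tau>\<in>quadruples N M. e_unit (phase (moments \<tau>) x)))\<^sup>2) \<in> borel_measurable borel"
      by (rule borel_measurable_continuous_onI)
    then show "(\<lambda>x. indicator (cbox 0 1) x *\<^sub>R (norm (\<Sum>\<tau>\<in>quadruples N M. e_unit (phase (moments \<tau>) x)))\<^sup>2)
        \<in> borel_measurable lborel"
      by simp
  qed
  also have "\<dots> = real (card {(\<tau>, \<tau>'). \<tau> \<in> quadruples N M \<and> \<tau>' \<in> quadruples N M \<and> moments \<tau> = moments \<tau>'})"
    by (rule integral_norm_sq_exponential_sum[OF finite_quadruples])
  finally show ?thesis .
qed

section \<open>From equal moments to meeting lines\<close>

text \<open>The last three rows of the $4 \times 4$ Hadamard matrix.  The first row, which consists of ones, yields the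
sum of the four numbers; the full matrix is twice an orthogonal one.\<close>

definition hadamard :: "int \<Rightarrow> int \<Rightarrow> int \<Rightarrow> int \<Rightarrow> int ^ 3" where
  "hadamard a b c d = vector [a + b - c - d, a - b + c - d, a - b - c + d]"

lemma dot_hadamard:
  "dot (hadamard a b c d) (hadamard a' b' c' d') + (a + b + c + d) * (a' + b' + c' + d')
     = 4 * (a * a' + b * b' + c * c' + d * d')"
  by (simp add: dot_def hadamard_def sum_3 algebra_simps)

lemma dot_diff_add: "dot (u - u') (u + u') = dot u u - dot u' u'"
  by (simp add: dot_def sum_subtractf algebra_simps)

lemma dot_polarized:
  "dot (u - u') (v + v') + dot (u + u') (v - v') = 2 * (dot u v - dot u' v')"
  by (simp add: dot_def sum_subtractf sum.distrib[symmetric] sum_distrib_left algebra_simps)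

lemma hadamard_box:
  assumes "{a, b, c, d, a', b', c', d'} \<subseteq> {1..int N}"
  shows "hadamard a b c d - hadamard a' b' c' d' \<in> int_box (4 * N)"
    and "hadamard a b c d + hadamard a' b' c' d' \<in> int_box (4 * N)"
proof -
  have "1 \<le> a" "a \<le> int N" "1 \<le> b" "b \<le> int N" "1 \<le> c" "c \<le> int N" "1 \<le> d" "d \<le> int N"
    "1 \<le> a'" "a' \<le> int N" "1 \<le> b'" "b' \<le> int N" "1 \<le> c'" "c' \<le> int N" "1 \<le> d'" "d' \<le> int N"
    using assms by simp_all
  then show "hadamard a b c d - hadamard a' b' c' d' \<in> int_box (4 * N)"
    "hadamard a b c d + hadamard a' b' c' d' \<in> int_box (4 * N)"
    unfolding int_box_def forall_3 hadamard_def by (simp_all add: abs_le_iff)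
qed

text \<open>Together with the sum, these are all coordinates of an invertible linear map.\<close>

lemma hadamard_inject:
  assumes "hadamard a b c d = hadamard a' b' c' d'" and "a + b + c + d = a' + b' + c' + d'"
  shows "a = a' \<and> b = b' \<and> c = c' \<and> d = d'"
proof -
  have "a + b - c - d = a' + b' - c' - d'" "a - b + c - d = a' - b' + c' - d'" "a - b - c + d = a' - b' - c' + d'"
    using assms(1) by (simp_all add: hadamard_def vec_eq_iff forall_3)
  then show ?thesis using assms(2) by (intro conjI; linarith)
qed

text \<open>For a quadruple $\tau$ let $u$ and $v$ be the Hadamard transforms of its first and second coordinates.
Since the Hadamard matrix is orthogonal up to a factor, two quadruples have equal moments iff they
have equal coordinate sums $s$, $t$ and the pairs $(u, v)$, $(u', v')$ have the same inner products
$u \cdot u$, $u \cdot v$, $v \cdot v$.  In terms of $x = u - u'$, $y = u + u'$, $p = v - v'$,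
$q = v + v'$ the latter equations become those of a pair of meeting lines.  The factor in front counts
the values of $s$ and $t$.\<close>

lemma card_equal_moments:
  "card {(\<tau>, \<tau>'). \<tau> \<in> quadruples N M \<and> \<tau>' \<in> quadruples N M \<and> moments \<tau> = moments \<tau>'}
     \<le> (4 * N * (4 * M)) * card (meeting_pairs (4 * N) (4 * M))"
proof -
  define E where "E = {(\<tau>, \<tau>'). \<tau> \<in> quadruples N M \<and> \<tau>' \<in> quadruples N M \<and> moments \<tau> = moments \<tau>'}"
  define u :: "quadruple \<Rightarrow> int ^ 3"
    where "u = (\<lambda>((w1, w2), (w3, w4)). hadamard (fst w1) (fst w2) (fst w3) (fst w4))"
  define v :: "quadruple \<Rightarrow> int ^ 3"
    where "v = (\<lambda>((w1, w2), (w3, w4)). hadamard (snd w1) (snd w2) (snd w3) (snd w4))"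
  define s where "s = (\<lambda>\<tau>. moments \<tau> $ 1)"
  define t where "t = (\<lambda>\<tau>. moments \<tau> $ 2)"
  define \<Theta> where "\<Theta> = (\<lambda>(\<tau>, \<tau>'). ((s \<tau>, t \<tau>), ((u \<tau> - u \<tau>', u \<tau> + u \<tau>'), (v \<tau> - v \<tau>', v \<tau> + v \<tau>'))))"
  have duu: "dot (u \<tau>) (u \<tau>) = 4 * moments \<tau> $ 4 - s \<tau> * s \<tau>"
    and dvv: "dot (v \<tau>) (v \<tau>) = 4 * moments \<tau> $ 5 - t \<tau> * t \<tau>"
    and duv: "dot (u \<tau>) (v \<tau>) = 4 * moments \<tau> $ 3 - s \<tau> * t \<tau>" for \<tau>
  proof -
    obtain n1 m1 n2 m2 n3 m3 n4 m4 where \<tau>: "\<tau> = (((n1, m1), (n2, m2)), ((n3, m3), (n4, m4)))"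
        by (rule quadruple_cases)
    show "dot (u \<tau>) (u \<tau>) = 4 * moments \<tau> $ 4 - s \<tau> * s \<tau>"
      using dot_hadamard[of n1 n2 n3 n4 n1 n2 n3 n4]
      by (simp add: \<tau> u_def s_def moments_def monomials_nth power2_eq_square algebra_simps)
    show "dot (v \<tau>) (v \<tau>) = 4 * moments \<tau> $ 5 - t \<tau> * t \<tau>"
      using dot_hadamard[of m1 m2 m3 m4 m1 m2 m3 m4]
      by (simp add: \<tau> v_def t_def moments_def monomials_nth power2_eq_square algebra_simps)
    show "dot (u \<tau>) (v \<tau>) = 4 * moments \<tau> $ 3 - s \<tau> * t \<tau>"
      using dot_hadamard[of n1 n2 n3 n4 m1 m2 m3 m4]
      by (simp add: \<tau> u_def v_def s_def t_def moments_def monomials_nth algebra_simps)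
  qed
  have inj: "inj_on \<Theta> E"
  proof (rule inj_onI)
    fix z z' assume z: "z \<in> E" "z' \<in> E" "\<Theta> z = \<Theta> z'"
    obtain \<tau> \<tau>' \<sigma> \<sigma>' where zz: "z = (\<tau>, \<tau>')" "z' = (\<sigma>, \<sigma>')" by (cases z, cases z') blast
    have eqs: "s \<tau> = s \<sigma>" "t \<tau> = t \<sigma>" "u \<tau> - u \<tau>' = u \<sigma> - u \<sigma>'" "u \<tau> + u \<tau>' = u \<sigma> + u \<sigma>'"
        "v \<tau> - v \<tau>' = v \<sigma> - v \<sigma>'" "v \<tau> + v \<tau>' = v \<sigma> + v \<sigma>'"
      using z(3) by (simp_all add: zz \<Theta>_def)
    have half: "a = c \<and> b = d" if "a - b = c - d" "a + b = c + d" for a b c d :: "int ^ 3"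
    proof -
      have "a $ i = c $ i \<and> b $ i = d $ i" for i
        using arg_cong[OF that(1), of "\<lambda>v. v $ i"] arg_cong[OF that(2), of "\<lambda>v. v $ i"] by simp
      then show ?thesis by (simp add: vec_eq_iff)
    qed
    have uv: "u \<tau> = u \<sigma>" "u \<tau>' = u \<sigma>'" "v \<tau> = v \<sigma>" "v \<tau>' = v \<sigma>'"
      using half[OF eqs(3,4)] half[OF eqs(5,6)] by simp_all
    have st: "s \<tau>' = s \<sigma>'" "t \<tau>' = t \<sigma>'"
      using z(1,2) eqs(1,2) by (simp_all add: zz E_def s_def t_def)
    have "\<rho> = \<rho>'" if "u \<rho> = u \<rho>'" "v \<rho> = v \<rho>'" "s \<rho> = s \<rho>'" "t \<rho> = t \<rho>'" for \<rho> \<rho>'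
    proof -
      obtain n1 m1 n2 m2 n3 m3 n4 m4 where \<rho>: "\<rho> = (((n1, m1), (n2, m2)), ((n3, m3), (n4, m4)))"
        by (rule quadruple_cases)
      obtain n1' m1' n2' m2' n3' m3' n4' m4' where \<rho>': "\<rho>' = (((n1', m1'), (n2', m2')), ((n3', m3'), (n4', m4')))"
        by (rule quadruple_cases)
      show ?thesis
        using that hadamard_inject[of n1 n2 n3 n4 n1' n2' n3' n4'] hadamard_inject[of m1 m2 m3 m4 m1' m2' m3' m4']
        by (simp add: \<rho> \<rho>' u_def v_def s_def t_def moments_def monomials_nth add.assoc)
    qed
    then show "z = z'" using uv eqs(1,2) st by (simp add: zz)
  qed
  have img: "\<Theta> ` E \<subseteq> ({1..int (4 * N)} \<times> {1..int (4 * M)}) \<times> meeting_pairs (4 * N) (4 * M)"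
  proof (rule image_subsetI)
    fix z assume "z \<in> E"
    then obtain \<tau> \<tau>' where z: "z = (\<tau>, \<tau>')" and q: "\<tau> \<in> quadruples N M" "\<tau>' \<in> quadruples N M"
      and m: "moments \<tau> = moments \<tau>'"
      by (auto simp: E_def)
    obtain n1 m1 n2 m2 n3 m3 n4 m4 where \<tau>: "\<tau> = (((n1, m1), (n2, m2)), ((n3, m3), (n4, m4)))"
        by (rule quadruple_cases)
    obtain n1' m1' n2' m2' n3' m3' n4' m4' where \<tau>': "\<tau>' = (((n1', m1'), (n2', m2')), ((n3', m3'), (n4', m4')))"
        by (rule quadruple_cases)
    have rn: "{n1, n2, n3, n4, n1', n2', n3', n4'} \<subseteq> {1..int N}"
      and rm: "{m1, m2, m3, m4, m1', m2', m3', m4'} \<subseteq> {1..int M}"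
      using q by (auto simp: \<tau> \<tau>' quadruples_def grid_def)
    have "s \<tau> \<in> {1..int (4 * N)}" "t \<tau> \<in> {1..int (4 * M)}"
      using rn rm by (auto simp: \<tau> s_def t_def moments_def monomials_nth)
    moreover have "u \<tau> - u \<tau>' \<in> int_box (4 * N)" "u \<tau> + u \<tau>' \<in> int_box (4 * N)"
      "v \<tau> - v \<tau>' \<in> int_box (4 * M)" "v \<tau> + v \<tau>' \<in> int_box (4 * M)"
      using hadamard_box[OF rn] hadamard_box[OF rm] by (simp_all add: \<tau> \<tau>' u_def v_def)
    moreover have "dot (u \<tau> - u \<tau>') (u \<tau> + u \<tau>') = 0" "dot (v \<tau> - v \<tau>') (v \<tau> + v \<tau>') = 0"
      "dot (u \<tau> - u \<tau>') (v \<tau> + v \<tau>') + dot (u \<tau> + u \<tau>') (v \<tau> - v \<tau>') = 0"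
      unfolding dot_diff_add dot_polarized using m by (simp_all add: duu dvv duv s_def t_def)
    ultimately show "\<Theta> z \<in> ({1..int (4 * N)} \<times> {1..int (4 * M)}) \<times> meeting_pairs (4 * N) (4 * M)"
      by (simp add: z \<Theta>_def meeting_pairs_def)
  qed
  have "card E \<le> card (({1..int (4 * N)} \<times> {1..int (4 * M)}) \<times> meeting_pairs (4 * N) (4 * M))"
    using inj img finite_meeting_pairs by (intro card_inj_on_le) auto
  also have "\<dots> = (4 * N * (4 * M)) * card (meeting_pairs (4 * N) (4 * M))"
    by (simp add: card_cartesian_product del: of_nat_mult)
  finally show ?thesis by (simp add: E_def)
qed

theorem theorem2p1:
  shows "\<forall>\<epsilon>::real. \<epsilon> > 0 \<longrightarrow>
    (\<exists>C::real. \<forall>N M :: nat. N \<ge> 1 \<longrightarrow> M \<ge> 1 \<longrightarrow>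
      Lp_norm 8 (cbox 0 1) (exp_sum N M) ^ 8
        \<le> C * (real N * real M) powr (1 + \<epsilon>)
            * (real N ^ 3 * real M ^ 3 + real N ^ 4 + real M ^ 4))"
proof (intro allI impI)
  fix \<epsilon> :: real
  assume \<epsilon>: "\<epsilon> > 0"
  obtain K where K: "K \<ge> 1" "\<forall>R T::nat. T \<ge> 1 \<longrightarrow> T \<le> R \<longrightarrow>
    real (card (meeting_pairs R T)) \<le> K * (real R powr (4 + \<epsilon>) + real R powr (3 + \<epsilon>) * real T powr (3 + \<epsilon>))"
    using card_meeting_pairs[OF \<epsilon>] by (elim exE conjE) (rule that)
  \<comment> \<open>the power of $4$ absorbs the factor $4$ in the two heights $4N$ and $4M$\<close>
  define B where "B = K * 4 powr (6 + 2 * \<epsilon>)"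
  have B0: "0 \<le> B" using K(1) by (simp add: B_def)
  have ordered: "real (card (meeting_pairs (4 * R) (4 * T)))
      \<le> B * (real R * real T) powr \<epsilon> * (real R ^ 3 * real T ^ 3 + real R ^ 4 + real T ^ 4)"
    if T: "T \<ge> 1" "T \<le> R" for R T :: nat
  proof -
    define r t where "r = real R" and "t = real T"
    have rt: "1 \<le> t" "1 \<le> r" using T by (simp_all add: r_def t_def)
    have "real (card (meeting_pairs (4 * R) (4 * T)))
        \<le> K * ((4 * r) powr (4 + \<epsilon>) + (4 * r) powr (3 + \<epsilon>) * (4 * t) powr (3 + \<epsilon>))"
      using K(2)[rule_format, of "4 * T" "4 * R"] T by (simp add: r_def t_def)
    also have "(4 * r) powr (4 + \<epsilon>) \<le> 4 powr (6 + 2 * \<epsilon>) * ((r * t) powr \<epsilon> * r ^ 4)"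
    proof -
      have "(4 * r) powr (4 + \<epsilon>) = 4 powr (4 + \<epsilon>) * (r powr \<epsilon> * r ^ 4)"
        using rt by (simp add: powr_mult powr_add mult_ac)
      also have "\<dots> \<le> 4 powr (6 + 2 * \<epsilon>) * ((r * t) powr \<epsilon> * r ^ 4)"
        using rt \<epsilon> by (intro mult_mono powr_mono powr_mono2) auto
      finally show ?thesis .
    qed
    also have "(4 * r) powr (3 + \<epsilon>) * (4 * t) powr (3 + \<epsilon>)
        = 4 powr (6 + 2 * \<epsilon>) * ((r * t) powr \<epsilon> * (r ^ 3 * t ^ 3))"
    proof -
      have "(4::real) powr (6 + 2 * \<epsilon>) = 4 powr (3 + \<epsilon>) * 4 powr (3 + \<epsilon>)"
        by (simp flip: powr_add)
      then show ?thesis using rt by (simp add: powr_mult powr_add[of r] powr_add[of t] mult_ac)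
    qed
    also have "K * (4 powr (6 + 2 * \<epsilon>) * ((r * t) powr \<epsilon> * r ^ 4) + 4 powr (6 + 2 * \<epsilon>) * ((r * t) powr \<epsilon> * (r ^ 3 * t ^ 3)))
        = B * (r * t) powr \<epsilon> * (r ^ 3 * t ^ 3 + r ^ 4)"
      by (simp add: B_def algebra_simps)
    also have "\<dots> \<le> B * (r * t) powr \<epsilon> * (r ^ 3 * t ^ 3 + r ^ 4 + t ^ 4)"
      using B0 by (intro mult_left_mono) auto
    finally show ?thesis using K(1) by (simp add: r_def t_def)
  qed
  have "Lp_norm 8 (cbox 0 1) (exp_sum N M) ^ 8
      \<le> (16 * B) * (real N * real M) powr (1 + \<epsilon>) * (real N ^ 3 * real M ^ 3 + real N ^ 4 + real M ^ 4)"
    if NM: "N \<ge> 1" "M \<ge> 1" for N M :: nat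
  proof -
    have J: "real (card (meeting_pairs (4 * N) (4 * M)))
        \<le> B * (real N * real M) powr \<epsilon> * (real N ^ 3 * real M ^ 3 + real N ^ 4 + real M ^ 4)"
    proof (cases "M \<le> N")
      case True
      then show ?thesis using ordered NM by blast
    next
      case False
      then show ?thesis
        using ordered[of N M] NM card_meeting_pairs_commute[of "4 * N" "4 * M"]
        by (simp add: mult.commute add_ac)
    qed
    have "Lp_norm 8 (cbox 0 1) (exp_sum N M) ^ 8 \<le> real ((4 * N * (4 * M)) * card (meeting_pairs (4 * N) (4 * M)))"
      unfolding Lp_norm_exp_sum using card_equal_moments by (rule of_nat_mono)
    also have "\<dots> = 16 * (real N * real M) * real (card (meeting_pairs (4 * N) (4 * M)))" by simp
    also have "\<dots> \<le> 16 * (real N * real M) * (B * (real N * real M) powr \<epsilon> * (real N ^ 3 * real M ^ 3 + real N ^ 4 + real M ^ 4))"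
      using J by (intro mult_left_mono) auto
    also have "\<dots> = (16 * B) * (real N * real M) powr (1 + \<epsilon>) * (real N ^ 3 * real M ^ 3 + real N ^ 4 + real M ^ 4)"
      using NM by (simp add: powr_add mult_ac)
    finally show ?thesis .
  qed
  then show "\<exists>C::real. \<forall>N M :: nat. N \<ge> 1 \<longrightarrow> M \<ge> 1 \<longrightarrow>
      Lp_norm 8 (cbox 0 1) (exp_sum N M) ^ 8
        \<le> C * (real N * real M) powr (1 + \<epsilon>)
            * (real N ^ 3 * real M ^ 3 + real N ^ 4 + real M ^ 4)"
    by blast
qed

end
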